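(* For every Kubo–Ando mean $\sigma$ and for every densely defined, lower semi-continuous trace $\tau$ on a $C^*$-algebra $A$ we have $$\tau(x\,\sigma\,y)\le \tau(x)\,\sigma\,\tau(y)$$ for all $x,y\in A_+$.
   Context: $A$ is a $C^*$-algebra of operators on some Hilbert space $\mathfrak{H}$, and $A_+$ is its set of positive elements. Let $\mathbf{B}_+=\mathbb{B}(\mathfrak{H})_+$ be the set of positive bounded operators on $\mathfrak{H}$. A Kubo–Ando mean on $\mathbf{B}_+$ is a function $\sigma:\mathbf{B}_+\times\mathbf{B}_+\to\mathbf{B}_+$ such that: (i) $\mathbf{1}\,\sigma\,\mathbf{1}=\mathbf{1}$; (ii) $x_1\,\sigma\,y_1\le x_2\,\sigma\,y_2$ if $x_1\le x_2$ and $y_1\le y_2$; (iii) $\sigma$ is jointly concave on $\mathbf{B}_+\times\mathbf{B}_+$; (iv) $z^*(x\,\sigma\,y)z=(z^*xz)\,\sigma\,(z^*yz)$ for every invertible $z\in\mathbb{B}(\mathfrak{H})$. For positive scalars $s,t$, the scalar $s\,\sigma\,t$ is obtained by identifying scalars with multiples of the identity $\mathbf{1}$. A trace on $A$ is a functional $\tau$ defined on $A_+$ with values in $[0,\infty]$ such that $\tau(x^*x)=\tau(xx^* )$ for all $x\in A$; densely defined means finite on a dense set of positive elements.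
   Formalization: If τ(x) or τ(y) is 0 or ∞, the scalar τ(x) σ τ(y) is read as a monotone limit (down at 0, up at ∞), since (i)–(iv) alone make the literal value at 0 fail; if x σ y is not in A, τ(x σ y) is the supremum of τ(a) over a in A₊ with a ≤ x σ y. *)

theory Defs
  imports "HOL-Analysis.Analysis"
begin

text \<open>
  Complex Hilbert spaces, as real Hilbert spaces with a compatible complex structure. The complex
  inner product is linear in its second argument; its real part is the given real inner product, so
  norm and topology are the library's.
\<close>

class chilbert_space = real_inner + complete_space +
  fixes scaleC :: "complex \<Rightarrow> 'a \<Rightarrow> 'a" (infixr \<open>*\<^sub>C\<close> 75)
    and cinner :: "'a \<Rightarrow> 'a \<Rightarrow> complex"
  assumes scaleC_add_right: "c *\<^sub>C (x + y) = c *\<^sub>C x + c *\<^sub>C y"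
    and scaleC_add_left: "(c + d) *\<^sub>C x = c *\<^sub>C x + d *\<^sub>C x"
    and scaleC_scaleC: "c *\<^sub>C d *\<^sub>C x = (c * d) *\<^sub>C x"
    and scaleC_of_real: "complex_of_real r *\<^sub>C x = r *\<^sub>R x"
    and cinner_commute: "cinner x y = cnj (cinner y x)"
    and cinner_add_right: "cinner x (y + z) = cinner x y + cinner x z"
    and cinner_scaleC_right: "cinner x (c *\<^sub>C y) = c * cinner x y"
    and Re_cinner: "Re (cinner x y) = x \<bullet> y"

subclass (in chilbert_space) banach ..

instantiation complex :: chilbert_space
begin

definition scaleC_complex :: "complex \<Rightarrow> complex \<Rightarrow> complex"
  where "scaleC_complex c x = c * x"

definition cinner_complex :: "complex \<Rightarrow> complex \<Rightarrow> complex"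
  where "cinner_complex x y = cnj x * y"

instance
  by standard
    (auto simp: scaleC_complex_def cinner_complex_def inner_complex_def algebra_simps
      scaleR_conv_of_real)

end

lemma norm_scaleC: "norm (c *\<^sub>C x) = cmod c * norm (x :: 'h :: chilbert_space)"
proof -
  have im: "Im (cinner x x) = 0"
    using arg_cong[OF cinner_commute[of x x], of Im] by simp
  have "cinner (c *\<^sub>C x) (c *\<^sub>C x) = c * (cnj c * cinner x x)"
    by (metis cinner_commute cinner_scaleC_right complex_cnj_mult)
  also have "\<dots> = complex_of_real ((cmod c)\<^sup>2) * cinner x x"
    by (simp add: complex_norm_square mult.assoc[symmetric] del: of_real_power)
  finally have "(c *\<^sub>C x) \<bullet> (c *\<^sub>C x) = (cmod c)\<^sup>2 * (x \<bullet> x)"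
    by (simp flip: Re_cinner)
  then have "(norm (c *\<^sub>C x))\<^sup>2 = (cmod c * norm x)\<^sup>2"
    by (simp add: power2_norm_eq_inner power_mult_distrib)
  then show ?thesis
    by (simp add: power2_eq_iff_nonneg)
qed


text \<open>
  The algebra of bounded complex-linear operators. Its ambient type consists of the bounded
  real-linear maps, which provides operator norm, topology and composition.
\<close>

definition bounded_ops :: "('h :: chilbert_space \<Rightarrow>\<^sub>L 'h) set"
  where "bounded_ops = {T. \<forall>c x. blinfun_apply T (c *\<^sub>C x) = c *\<^sub>C blinfun_apply T x}"

lift_definition scalar_op :: "complex \<Rightarrow> ('h :: chilbert_space \<Rightarrow>\<^sub>L 'h)" is "\<lambda>c x. c *\<^sub>C x"
proof (rule bounded_linear_intro)
  fix c r and x y :: 'h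
  show "c *\<^sub>C (x + y) = c *\<^sub>C x + c *\<^sub>C y"
    by (rule scaleC_add_right)
  show "c *\<^sub>C (r *\<^sub>R x) = r *\<^sub>R (c *\<^sub>C x)"
    by (simp add: scaleC_scaleC mult.commute flip: scaleC_of_real)
  show "norm (c *\<^sub>C x) \<le> norm x * cmod c"
    by (simp add: norm_scaleC)
qed

definition adj :: "('h :: chilbert_space \<Rightarrow>\<^sub>L 'h) \<Rightarrow> ('h \<Rightarrow>\<^sub>L 'h)"
  where "adj T = (THE S. \<forall>x y. cinner (blinfun_apply S x) y = cinner x (blinfun_apply T y))"

definition positive_ops :: "('h :: chilbert_space \<Rightarrow>\<^sub>L 'h) set"
  where "positive_ops = {T \<in> bounded_ops. \<forall>x. cinner x (blinfun_apply T x) \<in> \<real>\<^sub>\<ge>\<^sub>0}"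

definition op_le :: "('h :: chilbert_space \<Rightarrow>\<^sub>L 'h) \<Rightarrow> ('h \<Rightarrow>\<^sub>L 'h) \<Rightarrow> bool"  (infix \<open>\<sqsubseteq>\<close> 50)
  where "S \<sqsubseteq> T \<longleftrightarrow> T - S \<in> positive_ops"

definition invertible_op :: "('h :: chilbert_space \<Rightarrow>\<^sub>L 'h) \<Rightarrow> bool"
  where "invertible_op z \<longleftrightarrow> z \<in> bounded_ops \<and>
    (\<exists>w\<in>bounded_ops. z o\<^sub>L w = id_blinfun \<and> w o\<^sub>L z = id_blinfun)"


definition kubo_ando_mean ::
    "(('h :: chilbert_space \<Rightarrow>\<^sub>L 'h) \<Rightarrow> ('h \<Rightarrow>\<^sub>L 'h) \<Rightarrow> ('h \<Rightarrow>\<^sub>L 'h)) \<Rightarrow> bool"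
  where "kubo_ando_mean \<sigma> \<longleftrightarrow>
    (\<forall>x\<in>positive_ops. \<forall>y\<in>positive_ops. \<sigma> x y \<in> positive_ops) \<and>
    \<sigma> id_blinfun id_blinfun = id_blinfun \<and>
    (\<forall>x\<^sub>1\<in>positive_ops. \<forall>x\<^sub>2\<in>positive_ops. \<forall>y\<^sub>1\<in>positive_ops. \<forall>y\<^sub>2\<in>positive_ops.
      x\<^sub>1 \<sqsubseteq> x\<^sub>2 \<longrightarrow> y\<^sub>1 \<sqsubseteq> y\<^sub>2 \<longrightarrow> \<sigma> x\<^sub>1 y\<^sub>1 \<sqsubseteq> \<sigma> x\<^sub>2 y\<^sub>2) \<and>
    (\<forall>x\<^sub>1\<in>positive_ops. \<forall>x\<^sub>2\<in>positive_ops. \<forall>y\<^sub>1\<in>positive_ops. \<forall>y\<^sub>2\<in>positive_ops. \<forall>t\<in>{0..1::real}.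
      t *\<^sub>R \<sigma> x\<^sub>1 y\<^sub>1 + (1 - t) *\<^sub>R \<sigma> x\<^sub>2 y\<^sub>2 \<sqsubseteq>
        \<sigma> (t *\<^sub>R x\<^sub>1 + (1 - t) *\<^sub>R x\<^sub>2) (t *\<^sub>R y\<^sub>1 + (1 - t) *\<^sub>R y\<^sub>2)) \<and>
    (\<forall>x\<in>positive_ops. \<forall>y\<in>positive_ops. \<forall>z. invertible_op z \<longrightarrow>
      adj z o\<^sub>L \<sigma> x y o\<^sub>L z = \<sigma> (adj z o\<^sub>L x o\<^sub>L z) (adj z o\<^sub>L y o\<^sub>L z))"

text \<open>
  For \<open>s, t > 0\<close> the operator \<open>\<sigma> (s 1) (t 1)\<close> commutes with all unitaries, hence is a multiple of
  the identity.
\<close>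

definition scalar_mean ::
    "(('h :: chilbert_space \<Rightarrow>\<^sub>L 'h) \<Rightarrow> ('h \<Rightarrow>\<^sub>L 'h) \<Rightarrow> ('h \<Rightarrow>\<^sub>L 'h)) \<Rightarrow> real \<Rightarrow> real \<Rightarrow> real"
  where "scalar_mean \<sigma> s t = (THE c. \<sigma> (s *\<^sub>R id_blinfun) (t *\<^sub>R id_blinfun) = c *\<^sub>R id_blinfun)"

text \<open>
  The arguments of the scalar mean may also be \<open>0\<close> or \<open>\<infinity>\<close>; there it is extended by monotone
  limits, downwards at \<open>0\<close> and then upwards at \<open>\<infinity>\<close>. The order of the two limits matters only for
  the pairs \<open>(0, \<infinity>)\<close> and \<open>(\<infinity>, 0)\<close>, where the smaller of the two possible values is taken. The limit
  at \<open>0\<close> cannot be replaced by the value of \<open>\<sigma>\<close> at the operator \<open>0\<close>, because the axioms of a mean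
  do not enforce continuity there: the arithmetic mean modified to be \<open>0\<close> as soon as one of the two
  arguments is \<open>0\<close> still satisfies all of them.
\<close>

definition ext_scalar_mean ::
    "(('h :: chilbert_space \<Rightarrow>\<^sub>L 'h) \<Rightarrow> ('h \<Rightarrow>\<^sub>L 'h) \<Rightarrow> ('h \<Rightarrow>\<^sub>L 'h)) \<Rightarrow> ennreal \<Rightarrow> ennreal \<Rightarrow> ennreal"
  where "ext_scalar_mean \<sigma> s t =
    (if 0 < s \<and> s < \<infinity> \<and> 0 < t \<and> t < \<infinity>
     then ennreal (scalar_mean \<sigma> (enn2real s) (enn2real t))
     else SUP n::nat. INF e\<in>{0<..}.
       ennreal (scalar_mean \<sigma> (enn2real (min s (of_nat n)) + e) (enn2real (min t (of_nat n)) + e)))"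


text \<open>Norm-closed self-adjoint subalgebras, not necessarily containing the identity.\<close>

definition cstar_algebra :: "('h :: chilbert_space \<Rightarrow>\<^sub>L 'h) set \<Rightarrow> bool"
  where "cstar_algebra A \<longleftrightarrow>
    A \<subseteq> bounded_ops \<and> 0 \<in> A \<and> closed A \<and>
    (\<forall>x\<in>A. \<forall>y\<in>A. x + y \<in> A) \<and>
    (\<forall>c. \<forall>x\<in>A. scalar_op c o\<^sub>L x \<in> A) \<and>
    (\<forall>x\<in>A. \<forall>y\<in>A. x o\<^sub>L y \<in> A) \<and>
    (\<forall>x\<in>A. adj x \<in> A)"

definition positive_part :: "('h :: chilbert_space \<Rightarrow>\<^sub>L 'h) set \<Rightarrow> ('h \<Rightarrow>\<^sub>L 'h) set"
  where "positive_part A = A \<inter> positive_ops"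

text \<open>Only the values of \<open>\<tau>\<close> on the positive part of \<open>A\<close> are meaningful.\<close>

definition trace_on ::
    "('h :: chilbert_space \<Rightarrow>\<^sub>L 'h) set \<Rightarrow> (('h \<Rightarrow>\<^sub>L 'h) \<Rightarrow> ennreal) \<Rightarrow> bool"
  where "trace_on A \<tau> \<longleftrightarrow>
    (\<forall>x\<in>positive_part A. \<forall>y\<in>positive_part A. \<tau> (x + y) = \<tau> x + \<tau> y) \<and>
    (\<forall>x\<in>positive_part A. \<forall>r\<ge>0. \<tau> (r *\<^sub>R x) = ennreal r * \<tau> x) \<and>
    (\<forall>x\<in>A. \<tau> (adj x o\<^sub>L x) = \<tau> (x o\<^sub>L adj x))"

definition densely_defined ::
    "('h :: chilbert_space \<Rightarrow>\<^sub>L 'h) set \<Rightarrow> (('h \<Rightarrow>\<^sub>L 'h) \<Rightarrow> ennreal) \<Rightarrow> bool"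
  where "densely_defined A \<tau> \<longleftrightarrow> positive_part A \<subseteq> closure {x \<in> positive_part A. \<tau> x < \<infinity>}"

definition lower_semicontinuous_on ::
    "'a :: topological_space set \<Rightarrow> ('a \<Rightarrow> ennreal) \<Rightarrow> bool"
  where "lower_semicontinuous_on S f \<longleftrightarrow> (\<forall>c. closedin (top_of_set S) {x \<in> S. f x \<le> c})"

text \<open>
  For \<open>x, y\<close> in the positive part of \<open>A\<close> the operator \<open>\<sigma> x y\<close> need not lie in \<open>A\<close>: the
  geometric mean of two projections is the projection onto the intersection of their ranges.
  Outside \<open>A\<close> the trace is therefore extended from below.
\<close>

definition trace_value ::
    "('h :: chilbert_space \<Rightarrow>\<^sub>L 'h) set \<Rightarrow> (('h \<Rightarrow>\<^sub>L 'h) \<Rightarrow> ennreal) \<Rightarrow> ('h \<Rightarrow>\<^sub>L 'h) \<Rightarrow> ennreal"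
  where "trace_value A \<tau> b =
    (if b \<in> positive_part A then \<tau> b else SUP a\<in>{a \<in> positive_part A. a \<sqsubseteq> b}. \<tau> a)"

end

theory Submission
  imports Defs
begin

text \<open>
  If \<open>s \<sigma> t \<le> \<alpha> s + \<beta> t\<close> for all positive scalars, then \<open>x \<sigma> y \<le> \<alpha> x + \<beta> y\<close> for all positive
  operators: by pinching along a unit vector \<open>v\<close>, the vector state of \<open>x \<sigma> y\<close> at \<open>v\<close> is at most
  the scalar mean of (numbers just above) the vector states of \<open>x\<close> and \<open>y\<close>. Applying the trace
  gives \<open>\<alpha> \<tau>(x) + \<beta> \<tau>(y)\<close> as an upper bound, and the scalar mean, being concave and homogeneous,
  is the infimum of its linear majorants. Infinite traces are handled by suitable choices of
  \<open>\<alpha>\<close> and \<open>\<beta>\<close>, except for \<open>\<tau>(x) = \<infinity>\<close>, \<open>\<tau>(y) = 0\<close> (or vice versa), where lower semi-continuity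
  enters: then \<open>x \<sigma> y\<close> vanishes modulo the ideal of trace-null elements.
\<close>

section \<open>Complex inner products, self-adjoint and positive operators\<close>

lemma Im_cinner: "Im (cinner x y) = - (x \<bullet> (\<i> *\<^sub>C (y :: 'h :: chilbert_space)))"
  using arg_cong[OF cinner_scaleC_right[of x \<i> y], of Re] by (simp add: Re_cinner)

text \<open>The imaginary part of \<open>cinner x y\<close> is, up to sign, the real inner product
  of \<open>x\<close> with \<open>\<i> *\<^sub>C y\<close>, so two real identities decide a complex
  one.\<close>

lemma cinner_eqI:
  fixes x y :: "'h :: chilbert_space"
  assumes "x \<bullet> y = x' \<bullet> y'" "x \<bullet> (\<i> *\<^sub>C y) = x' \<bullet> (\<i> *\<^sub>C y')"
  shows "cinner x y = cinner x' y'"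
  using assms by (simp add: complex_eq_iff Re_cinner Im_cinner)

lemma cinner_scaleC_left: "cinner (c *\<^sub>C x) y = cnj c * cinner x (y :: 'h :: chilbert_space)"
  by (metis cinner_commute cinner_scaleC_right complex_cnj_mult)

lemma inner_scaleC_scaleC: "(c *\<^sub>C x) \<bullet> (c *\<^sub>C y) = (cmod c)\<^sup>2 * (x \<bullet> (y :: 'h :: chilbert_space))"
proof -
  have "cinner (c *\<^sub>C x) (c *\<^sub>C y) = complex_of_real ((cmod c)\<^sup>2) * cinner x y"
    by (simp add: cinner_scaleC_left cinner_scaleC_right complex_norm_square mult_ac
        del: of_real_power)
  then show ?thesis
    by (simp flip: Re_cinner)
qed

lemma norm_cinner_le: "cmod (cinner x y) \<le> norm x * norm (y :: 'h :: chilbert_space)"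
proof (cases "cinner x y = 0")
  case False
  \<comment> \<open>The phase that rotates \<open>cinner x y\<close> onto its modulus; the rotated
    value is real, so the real Cauchy-Schwarz inequality applies.\<close>
  define c where "c = cnj (cinner x y) / cmod (cinner x y)"
  have "cmod c = 1"
    using False by (simp add: c_def norm_divide)
  have "c * cinner x y = complex_of_real (cmod (cinner x y))"
    using False unfolding c_def
    by (metis complex_norm_square mult.commute nonzero_mult_div_cancel_left norm_eq_zero
        of_real_eq_0_iff power2_eq_square times_divide_eq_left of_real_mult of_real_power)
  then have "cmod (cinner x y) = x \<bullet> (c *\<^sub>C y)"
    by (metis Re_cinner Re_complex_of_real cinner_scaleC_right)
  also have "\<dots> \<le> norm x * norm (c *\<^sub>C y)"
    by (rule norm_cauchy_schwarz)
  finally show ?thesis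
    using \<open>cmod c = 1\<close> by (simp add: norm_scaleC)
qed simp

text \<open>Symmetry is asked only for the real inner product; complex linearity upgrades it to the
  complex one in \<open>cinner_selfadjoint\<close>.\<close>

definition selfadjoint_ops :: "('h :: chilbert_space \<Rightarrow>\<^sub>L 'h) set"
  where "selfadjoint_ops = {T \<in> bounded_ops. \<forall>x y. T x \<bullet> y = x \<bullet> T y}"

lemma selfadjoint_opsD:
  assumes "T \<in> selfadjoint_ops"
  shows "T (c *\<^sub>C x) = c *\<^sub>C T x" "T x \<bullet> y = x \<bullet> T y" "T \<in> bounded_ops"
  using assms by (auto simp: selfadjoint_ops_def bounded_ops_def)

lemma scaleC_scaleR: "c *\<^sub>C (r *\<^sub>R x) = r *\<^sub>R (c *\<^sub>C (x :: 'h :: chilbert_space))"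
  by (simp add: scaleC_scaleC mult.commute flip: scaleC_of_real)

lemma scaleC_diff_right: "c *\<^sub>C (x - y) = c *\<^sub>C x - c *\<^sub>C (y :: 'h :: chilbert_space)"
  by (metis add_diff_cancel diff_add_cancel scaleC_add_right)

lemma selfadjoint_ops_intros:
  assumes "S \<in> selfadjoint_ops" "T \<in> selfadjoint_ops"
  shows "S + T \<in> selfadjoint_ops" "S - T \<in> selfadjoint_ops" "S o\<^sub>L T o\<^sub>L S \<in> selfadjoint_ops"
  using assms
  by (auto simp: selfadjoint_ops_def bounded_ops_def blinfun.add_left blinfun.diff_left
      blinfun.scaleR_left inner_add_left inner_add_right inner_diff_left inner_diff_right
      scaleC_add_right scaleC_diff_right scaleC_scaleR)

lemma scaleR_selfadjoint: "S \<in> selfadjoint_ops \<Longrightarrow> r *\<^sub>R S \<in> selfadjoint_ops"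
  by (simp add: selfadjoint_ops_def bounded_ops_def blinfun.scaleR_left scaleC_scaleR)

lemma id_selfadjoint: "id_blinfun \<in> selfadjoint_ops"
  by (simp add: selfadjoint_ops_def bounded_ops_def)

lemma cinner_selfadjoint:
  assumes "T \<in> selfadjoint_ops"
  shows "cinner (T x) y = cinner x (T y)"
  by (rule cinner_eqI) (simp_all add: selfadjoint_opsD(2)[OF assms]
      flip: selfadjoint_opsD(1)[OF assms])

text \<open>Inner products determine vectors, so the definite description behind \<open>adj\<close>
  has a single solution. The congruences of means below are all taken with self-adjoint
  operators.\<close>

lemma adj_selfadjoint:
  assumes "T \<in> selfadjoint_ops"
  shows "adj T = T"
  unfolding adj_def
proof (rule the_equality)
  show "\<forall>x y. cinner (T x) y = cinner x (T y)"
    using cinner_selfadjoint[OF assms] by blast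
next
  fix S assume S: "\<forall>x y. cinner (blinfun_apply S x) y = cinner x (T y)"
  show "S = T"
  proof (rule blinfun_eqI)
    fix x
    have "S x \<bullet> y = T x \<bullet> y" for y
      using S cinner_selfadjoint[OF assms, of x y] by (metis Re_cinner)
    then show "S x = T x"
      by (metis vector_eq_rdot)
  qed
qed

text \<open>Symmetry comes from polarisation: if the complex form is real at \<open>u\<close>,
  \<open>v\<close> and \<open>u + v\<close>, the imaginary parts of its cross terms cancel, and the
  complex structure turns this into a statement about real parts.\<close>

lemma positive_ops_iff: "T \<in> positive_ops \<longleftrightarrow> T \<in> selfadjoint_ops \<and> (\<forall>x. 0 \<le> x \<bullet> T x)"
proof
  assume T: "T \<in> positive_ops"
  have lin: "T (c *\<^sub>C x) = c *\<^sub>C T x" for c x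
    using T by (auto simp: positive_ops_def bounded_ops_def)
  have im: "Im (cinner x (T x)) = 0" and re: "0 \<le> x \<bullet> T x" for x
    using T by (auto simp: positive_ops_def complex_nonneg_Reals_iff simp flip: Re_cinner)
  have "x \<bullet> T y = T x \<bullet> y" for x y
  proof -
    have i: "u \<bullet> (\<i> *\<^sub>C T v) + v \<bullet> (\<i> *\<^sub>C T u) = 0" for u v
      using im[of "u + v"] im[of u] im[of v]
      by (simp add: Im_cinner blinfun.add_right scaleC_add_right inner_add_left inner_add_right)
    have "(\<i> *\<^sub>C y) \<bullet> (\<i> *\<^sub>C T x) = y \<bullet> T x"
      by (simp add: inner_scaleC_scaleC)
    moreover have "\<i> *\<^sub>C \<i> *\<^sub>C T y = - T y"
      using scaleC_of_real[of "-1" "T y"] by (simp add: scaleC_scaleC)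
    \<comment> \<open>Polarisation with \<open>u = x\<close> and \<open>v = \<i> *\<^sub>C y\<close>
      gives \<open>- (x \<bullet> T y) + y \<bullet> T x = 0\<close>.\<close>
    ultimately show ?thesis
      using i[of x "\<i> *\<^sub>C y"] by (simp add: lin inner_commute)
  qed
  then show "T \<in> selfadjoint_ops \<and> (\<forall>x. 0 \<le> x \<bullet> T x)"
    using re T by (auto simp: selfadjoint_ops_def positive_ops_def)
next
  assume T: "T \<in> selfadjoint_ops \<and> (\<forall>x. 0 \<le> x \<bullet> T x)"
  have "Im (cinner x (T x)) = 0" for x
    using cinner_selfadjoint[of T x x] arg_cong[OF cinner_commute[of x "T x"], of Im] T by simp
  then show "T \<in> positive_ops"
    using T by (auto simp: positive_ops_def complex_nonneg_Reals_iff Re_cinner selfadjoint_ops_def)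
qed

lemma positive_opsD:
  assumes "T \<in> positive_ops"
  shows "T \<in> selfadjoint_ops" "0 \<le> x \<bullet> T x"
  using assms by (auto simp: positive_ops_iff)

lemma op_le_iff:
  assumes "S \<in> selfadjoint_ops" "T \<in> selfadjoint_ops"
  shows "S \<sqsubseteq> T \<longleftrightarrow> (\<forall>x. x \<bullet> S x \<le> x \<bullet> T x)"
  using assms
  by (auto simp: op_le_def positive_ops_iff selfadjoint_ops_intros blinfun.diff_left inner_diff_right)

lemma add_positive: "S \<in> positive_ops \<Longrightarrow> T \<in> positive_ops \<Longrightarrow> S + T \<in> positive_ops"
  by (simp add: positive_ops_iff selfadjoint_ops_intros blinfun.add_left inner_add_right)

lemma scaleR_positive: "0 \<le> r \<Longrightarrow> S \<in> positive_ops \<Longrightarrow> r *\<^sub>R S \<in> positive_ops"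
  by (simp add: positive_ops_iff scaleR_selfadjoint blinfun.scaleR_left)

lemma positive_congruence:
  assumes "S \<in> selfadjoint_ops" "T \<in> positive_ops"
  shows "S o\<^sub>L T o\<^sub>L S \<in> positive_ops"
  using assms positive_opsD(2)[OF assms(2), of "S x" for x]
  by (auto simp: positive_ops_iff selfadjoint_ops_intros selfadjoint_opsD(2)[OF assms(1), symmetric])

lemma id_positive: "id_blinfun \<in> positive_ops"
  by (simp add: positive_ops_iff id_selfadjoint)

section \<open>Quadratic forms and norms\<close>

lemma inner_blinfun_le: "x \<bullet> blinfun_apply T x \<le> norm T * (norm x)\<^sup>2"
proof -
  have "x \<bullet> T x \<le> norm x * norm (T x)"
    by (rule norm_cauchy_schwarz)
  also have "\<dots> \<le> norm x * (norm T * norm x)"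
    by (intro mult_left_mono norm_blinfun) simp
  finally show ?thesis
    by (simp add: power2_eq_square mult_ac)
qed

text \<open>For \<open>0 \<le> T \<le> 1\<close> one has \<open>T - T\<^sup>2 = T (1 - T) T + (1 - T) T (1 - T)\<close>.\<close>

lemma norm_sq_le_contraction:
  assumes "T \<in> positive_ops" "norm T \<le> 1"
  shows "(norm (T v))\<^sup>2 \<le> v \<bullet> T v"
proof -
  have "T v \<bullet> T (T v) \<le> 1 * (norm (T v))\<^sup>2"
    by (rule order_trans[OF inner_blinfun_le]) (intro mult_right_mono assms, simp)
  moreover have "0 \<le> (v - T v) \<bullet> T (v - T v)"
    by (rule positive_opsD(2)[OF assms(1)])
  moreover have "v \<bullet> T (T v) = T v \<bullet> T v"
    using selfadjoint_opsD(2)[OF positive_opsD(1)[OF assms(1)]] by simp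
  ultimately show ?thesis
    by (simp add: power2_norm_eq_inner blinfun.diff_right inner_diff_left inner_diff_right)
qed

text \<open>Rescaling to norm one reduces this to the case of a contraction.\<close>

lemma norm_sq_le:
  assumes "T \<in> positive_ops"
  shows "(norm (T v))\<^sup>2 \<le> norm T * (v \<bullet> T v)"
proof (cases "norm T = 0")
  case False
  define r where "r = inverse (norm T)"
  have r: "r > 0" "r * norm T = 1"
    using False by (auto simp: r_def)
  have "(norm ((r *\<^sub>R T) v))\<^sup>2 \<le> v \<bullet> (r *\<^sub>R T) v"
    using r by (intro norm_sq_le_contraction scaleR_positive assms) auto
  then have "r * (r * (norm (T v))\<^sup>2) \<le> r * (v \<bullet> T v)"
    using r by (simp add: blinfun.scaleR_left power_mult_distrib power2_eq_square mult_ac)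
  then have "r * (norm (T v))\<^sup>2 \<le> v \<bullet> T v"
    using r by simp
  then have "norm T * (r * (norm (T v))\<^sup>2) \<le> norm T * (v \<bullet> T v)"
    by (intro mult_left_mono) auto
  then show ?thesis
    using r by (simp add: mult.assoc[symmetric] mult.commute[of "norm T"])
qed simp

section \<open>Projections onto lines and their dilations\<close>

lift_definition rank_one :: "'h :: chilbert_space \<Rightarrow> 'h \<Rightarrow>\<^sub>L 'h" is "\<lambda>v x. cinner v x *\<^sub>C v"
proof (rule bounded_linear_intro)
  fix v x y :: 'h and r :: real
  show "cinner v (x + y) *\<^sub>C v = cinner v x *\<^sub>C v + cinner v y *\<^sub>C v"
    by (simp add: cinner_add_right scaleC_add_left)
  show "cinner v (r *\<^sub>R x) *\<^sub>C v = r *\<^sub>R cinner v x *\<^sub>C v"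
    by (metis cinner_scaleC_right scaleC_of_real scaleC_scaleC)
  show "norm (cinner v x *\<^sub>C v) \<le> norm x * (norm v * norm v)"
    using mult_right_mono[OF norm_cinner_le[of v x], of "norm v"] by (simp add: norm_scaleC mult_ac)
qed

lemma rank_one_selfadjoint: "rank_one v \<in> selfadjoint_ops"
proof -
  have "cinner (rank_one v x) y = cinner x (rank_one v y)" for x y
    using cinner_commute[of v x]
    by (simp add: rank_one.rep_eq cinner_scaleC_left cinner_scaleC_right mult.commute)
  then have "rank_one v x \<bullet> y = x \<bullet> rank_one v y" for x y
    by (metis Re_cinner)
  then show ?thesis
    by (simp add: selfadjoint_ops_def bounded_ops_def rank_one.rep_eq cinner_scaleC_right scaleC_scaleC)
qed

lemma cinner_self: "cinner v v = complex_of_real ((norm v)\<^sup>2)"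
  using arg_cong[OF cinner_commute[of v v], of Im]
  by (simp add: complex_eq_iff Re_cinner power2_norm_eq_inner del: of_real_power)

lemma rank_one_rank_one: "norm v = 1 \<Longrightarrow> rank_one v (rank_one v x) = rank_one v x"
  by (simp add: rank_one.rep_eq cinner_scaleC_right cinner_self)

lemma rank_one_self: "norm v = 1 \<Longrightarrow> rank_one v v = v"
  using scaleC_of_real[of 1 v] by (simp add: rank_one.rep_eq cinner_self)

text \<open>
  With \<open>P\<close> the projection onto the line of the unit vector \<open>v\<close>, this is \<open>P + r (1 - P)\<close>; it is a
  reflection for \<open>r = -1\<close>.
\<close>

definition dilation :: "'h :: chilbert_space \<Rightarrow> real \<Rightarrow> 'h \<Rightarrow>\<^sub>L 'h"
  where "dilation v r = r *\<^sub>R id_blinfun + (1 - r) *\<^sub>R rank_one v"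

lemma dilation_apply: "dilation v r x = rank_one v x + r *\<^sub>R (x - rank_one v x)"
  by (simp add: dilation_def blinfun.add_left blinfun.diff_left blinfun.scaleR_left scaleR_diff_left scaleR_diff_right)

lemma dilation_selfadjoint: "dilation v r \<in> selfadjoint_ops"
  unfolding dilation_def by (intro selfadjoint_ops_intros scaleR_selfadjoint id_selfadjoint rank_one_selfadjoint)

lemma dilation_self: "norm v = 1 \<Longrightarrow> dilation v r v = v"
  by (simp add: dilation_apply rank_one_self)

text \<open>The projection is idempotent, so the factors on the orthogonal complement multiply:
  \<open>r = -1\<close> gives an involution and \<open>r \<noteq> 0\<close> an invertible
  operator.\<close>

lemma dilation_dilation: "norm v = 1 \<Longrightarrow> dilation v r (dilation v s x) = dilation v (r * s) x"
  by (simp add: dilation_apply blinfun.add_right blinfun.diff_right blinfun.scaleR_right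
      rank_one_rank_one)

lemma dilation_invertible:
  assumes "norm v = 1" "r \<noteq> 0"
  shows "invertible_op (dilation v r)"
  unfolding invertible_op_def
proof (intro conjI bexI)
  have [simp]: "dilation v 1 x = x" for x
    by (simp add: dilation_apply)
  show "dilation v r o\<^sub>L dilation v (inverse r) = id_blinfun"
    "dilation v (inverse r) o\<^sub>L dilation v r = id_blinfun"
    using assms by (auto intro!: blinfun_eqI simp: dilation_dilation)
qed (use dilation_selfadjoint selfadjoint_opsD in blast)+

text \<open>Split \<open>x\<close> into its component \<open>p\<close> along \<open>v\<close> and
  the orthogonal rest \<open>q\<close>. Adding the values for \<open>r\<close> and
  \<open>- r\<close> cancels the cross terms; the form at \<open>p\<close> is controlled by the
  state at \<open>v\<close>, the form at \<open>q\<close> by the factor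
  \<open>r\<^sup>2\<close>.\<close>

lemma inner_pinch_le:
  assumes T: "T \<in> positive_ops" and v: "norm v = 1" and a: "v \<bullet> T v \<le> a"
    and r: "r\<^sup>2 * norm T \<le> a"
  shows "dilation v r x \<bullet> T (dilation v r x) + dilation v (- r) x \<bullet> T (dilation v (- r) x)
    \<le> 2 * a * (norm x)\<^sup>2"
proof -
  define p where "p = rank_one v x"
  define q where "q = x - p"
  have orth: "p \<bullet> q = 0"
    using selfadjoint_opsD(2)[OF rank_one_selfadjoint, of v x "x - p"] rank_one_rank_one[OF v, of x]
    by (simp add: p_def q_def blinfun.diff_right)
  have "p \<bullet> T p = (cmod (cinner v x))\<^sup>2 * (v \<bullet> T v)"
    by (simp add: p_def rank_one.rep_eq selfadjoint_opsD(1)[OF positive_opsD(1)[OF T]]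
        inner_scaleC_scaleC)
  also have "\<dots> \<le> (cmod (cinner v x))\<^sup>2 * a"
    by (intro mult_left_mono a) simp
  also have "(cmod (cinner v x))\<^sup>2 = (norm p)\<^sup>2"
    by (simp add: p_def rank_one.rep_eq norm_scaleC v)
  finally have p: "p \<bullet> T p \<le> (norm p)\<^sup>2 * a" .
  have "r\<^sup>2 * (q \<bullet> T q) \<le> r\<^sup>2 * (norm T * (norm q)\<^sup>2)"
    by (intro mult_left_mono inner_blinfun_le) simp
  also have "\<dots> \<le> a * (norm q)\<^sup>2"
    using mult_right_mono[OF r, of "(norm q)\<^sup>2"] by (simp add: mult.assoc)
  finally have q: "r\<^sup>2 * (q \<bullet> T q) \<le> (norm q)\<^sup>2 * a"
    by (simp add: mult.commute)
  have "(norm x)\<^sup>2 = (norm p)\<^sup>2 + (norm q)\<^sup>2"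
    using orth unfolding q_def
    by (simp add: power2_norm_eq_inner inner_diff_left inner_diff_right inner_commute)
  moreover have "dilation v r x \<bullet> T (dilation v r x) + dilation v (- r) x \<bullet> T (dilation v (- r) x)
      = 2 * (p \<bullet> T p) + 2 * (r\<^sup>2 * (q \<bullet> T q))"
    unfolding dilation_apply p_def[symmetric] q_def[symmetric]
    by (simp add: blinfun.add_right blinfun.diff_right blinfun.scaleR_right blinfun.minus_right inner_add_left
        inner_add_right inner_diff_left inner_diff_right power2_eq_square algebra_simps)
  ultimately show ?thesis
    using p q by (simp add: algebra_simps)
qed

lemma dilation_congruence_scalar:
  assumes "norm v = 1"
  shows "dilation v (-1) o\<^sub>L (s *\<^sub>R id_blinfun) o\<^sub>L dilation v (-1) = s *\<^sub>R id_blinfun"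
  using assms
  by (intro blinfun_eqI)
    (simp add: blinfun.scaleR_left blinfun.scaleR_right dilation_dilation, simp add: dilation_apply)

section \<open>Scalar operators and linear majorants of homogeneous concave functions\<close>

lemma scalar_of_eigenvectors:
  fixes T :: "'h :: real_normed_vector \<Rightarrow>\<^sub>L 'h"
  assumes "\<And>v. \<exists>r. T v = r *\<^sub>R v"
  shows "\<exists>c. T = c *\<^sub>R id_blinfun"
proof (cases "\<exists>e :: 'h. e \<noteq> 0")
  case True
  then obtain e :: 'h where e: "e \<noteq> 0" by blast
  obtain c where c: "T e = c *\<^sub>R e"
    using assms by blast
  have "T v = c *\<^sub>R v" for v
  proof -
    obtain l k where l: "T v = l *\<^sub>R v" and k: "T (v + e) = k *\<^sub>R (v + e)"
      using assms by meson
    \<comment> \<open>Comparing the eigenvalues of \<open>v\<close>, \<open>e\<close> and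
      \<open>v + e\<close>: either they all agree, or \<open>v\<close> is a multiple of
      \<open>e\<close> and inherits the eigenvalue \<open>c\<close>.\<close>
    have eq: "(k - l) *\<^sub>R v = (c - k) *\<^sub>R e"
      using k l c by (simp add: blinfun.add_right algebra_simps)
    show ?thesis
    proof (cases "k = l")
      case True
      then show ?thesis
        using eq e l by simp
    next
      case False
      then have "v = ((c - k) / (k - l)) *\<^sub>R e"
        using arg_cong[OF eq, of "\<lambda>w. inverse (k - l) *\<^sub>R w"] by (simp add: divide_inverse mult.commute)
      then show ?thesis
        using c by (metis blinfun.scaleR_right scaleR_left_commute)
    qed
  qed
  then show ?thesis
    by (intro exI[of _ c] blinfun_eqI) (simp add: blinfun.scaleR_left)
next
  case False
  then show ?thesis
    by (intro exI[of _ 0] blinfun_eqI) metis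
qed

text \<open>The line supporting the concave function \<open>m 1\<close> at \<open>t / s\<close>,
  made homogeneous, is the majorant. Its slope is nonnegative by monotonicity, its intercept because
  \<open>m 1\<close> stays nonnegative near \<open>0\<close>.\<close>

lemma dominating_support:
  fixes m :: "real \<Rightarrow> real \<Rightarrow> real"
  assumes nonneg: "\<And>r. 0 < r \<Longrightarrow> 0 \<le> m 1 r"
    and mono: "\<And>r r'. 0 < r \<Longrightarrow> r \<le> r' \<Longrightarrow> m 1 r \<le> m 1 r'"
    and hom: "\<And>s t. 0 < s \<Longrightarrow> 0 < t \<Longrightarrow> m s t = s * m 1 (t / s)"
    and conc: "concave_on {0<..} (m 1)"
    and st: "0 < s" "0 < t"
  obtains \<alpha> \<beta> where "0 \<le> \<alpha>" "0 \<le> \<beta>" "m s t = \<alpha> * s + \<beta> * t"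
    "\<And>s' t'. 0 < s' \<Longrightarrow> 0 < t' \<Longrightarrow> m s' t' \<le> \<alpha> * s' + \<beta> * t'"
proof -
  define f where "f = m 1"
  define r where "r = t / s"
  have r: "0 < r"
    using st by (simp add: r_def)
  \<comment> \<open>The subgradient \<open>k\<close> of the convex function \<open>- f\<close> at
    \<open>r\<close> is the infimum of its difference quotients to the right of
    \<open>r\<close>.\<close>
  obtain k where k': "- f y \<ge> - f r + k * (y - r)" if "0 < y" for y
  proof
    show "- f y \<ge> - f r + Inf ((\<lambda>t. (- f r - - f t) / (r - t)) ` ({r<..} \<inter> {0<..})) * (y - r)"
      if "0 < y" for y
      using conc r that
      by (intro convex_le_Inf_differential) (auto simp: concave_on_def f_def interior_open)
  qed
  define \<beta> where "\<beta> = - k"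
  have k: "f y \<le> f r + \<beta> * (y - r)" if "0 < y" for y
    using k'[OF that] by (simp add: \<beta>_def)
  define \<alpha> where "\<alpha> = f r - \<beta> * r"
  have le: "f y \<le> \<alpha> + \<beta> * y" if "0 < y" for y
    using k[OF that] by (simp add: \<alpha>_def algebra_simps)
  have \<beta>: "0 \<le> \<beta>"
    using k[of "r + 1"] mono[of r "r + 1"] r by (simp add: f_def)
  have \<alpha>: "0 \<le> \<alpha>"
  proof (rule ccontr)
    assume "\<not> 0 \<le> \<alpha>"
    \<comment> \<open>A point where the majorant \<open>\<alpha> + \<beta> * y\<close> equals
      \<open>- y\<close>, contradicting nonnegativity of \<open>f\<close>.\<close>
    define y where "y = - \<alpha> / (\<beta> + 1)"
    have y: "0 < y" "(\<beta> + 1) * y = - \<alpha>"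
      using \<open>\<not> 0 \<le> \<alpha>\<close> \<beta> by (simp_all add: y_def divide_neg_pos)
    have "\<beta> * y + y = - \<alpha>"
      using y(2) by (simp add: distrib_right)
    then show False
      using le[OF y(1)] nonneg[OF y(1)] y(1) by (simp add: f_def)
  qed
  show thesis
  proof
    show "m s t = \<alpha> * s + \<beta> * t"
      using hom[of s t] st by (simp add: \<alpha>_def f_def r_def field_simps)
    fix s' t' :: real assume *: "0 < s'" "0 < t'"
    then have "s' * f (t' / s') \<le> s' * (\<alpha> + \<beta> * (t' / s'))"
      by (intro mult_left_mono le) auto
    then show "m s' t' \<le> \<alpha> * s' + \<beta> * t'"
      using hom[OF *] * by (simp add: f_def algebra_simps)
  qed (fact \<alpha> \<beta>)+
qed

section \<open>Kubo-Ando means in vector states\<close>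

context
  fixes \<sigma> :: "('h :: chilbert_space \<Rightarrow>\<^sub>L 'h) \<Rightarrow> ('h \<Rightarrow>\<^sub>L 'h) \<Rightarrow> ('h \<Rightarrow>\<^sub>L 'h)"
  assumes mean: "kubo_ando_mean \<sigma>"
begin

lemma mean_positive: "x \<in> positive_ops \<Longrightarrow> y \<in> positive_ops \<Longrightarrow> \<sigma> x y \<in> positive_ops"
  using mean by (simp add: kubo_ando_mean_def)

lemma mean_mono:
  assumes "x\<^sub>1 \<in> positive_ops" "x\<^sub>2 \<in> positive_ops" "y\<^sub>1 \<in> positive_ops" "y\<^sub>2 \<in> positive_ops"
    and "\<And>v. v \<bullet> x\<^sub>1 v \<le> v \<bullet> x\<^sub>2 v" "\<And>v. v \<bullet> y\<^sub>1 v \<le> v \<bullet> y\<^sub>2 v"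
  shows "v \<bullet> \<sigma> x\<^sub>1 y\<^sub>1 v \<le> v \<bullet> \<sigma> x\<^sub>2 y\<^sub>2 v"
proof -
  have "x\<^sub>1 \<sqsubseteq> x\<^sub>2" "y\<^sub>1 \<sqsubseteq> y\<^sub>2"
    using assms by (auto simp: op_le_iff positive_opsD)
  then have "\<sigma> x\<^sub>1 y\<^sub>1 \<sqsubseteq> \<sigma> x\<^sub>2 y\<^sub>2"
    using mean assms unfolding kubo_ando_mean_def by blast
  then show ?thesis
    using assms by (simp add: op_le_iff positive_opsD mean_positive)
qed

lemma mean_concave:
  assumes "x\<^sub>1 \<in> positive_ops" "x\<^sub>2 \<in> positive_ops" "y\<^sub>1 \<in> positive_ops" "y\<^sub>2 \<in> positive_ops"
    and "0 \<le> t" "t \<le> 1"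
  shows "t * (v \<bullet> \<sigma> x\<^sub>1 y\<^sub>1 v) + (1 - t) * (v \<bullet> \<sigma> x\<^sub>2 y\<^sub>2 v)
    \<le> v \<bullet> \<sigma> (t *\<^sub>R x\<^sub>1 + (1 - t) *\<^sub>R x\<^sub>2) (t *\<^sub>R y\<^sub>1 + (1 - t) *\<^sub>R y\<^sub>2) v"
proof -
  have "t *\<^sub>R \<sigma> x\<^sub>1 y\<^sub>1 + (1 - t) *\<^sub>R \<sigma> x\<^sub>2 y\<^sub>2
      \<sqsubseteq> \<sigma> (t *\<^sub>R x\<^sub>1 + (1 - t) *\<^sub>R x\<^sub>2) (t *\<^sub>R y\<^sub>1 + (1 - t) *\<^sub>R y\<^sub>2)"
    using mean assms unfolding kubo_ando_mean_def by auto
  then have "v \<bullet> (t *\<^sub>R \<sigma> x\<^sub>1 y\<^sub>1 + (1 - t) *\<^sub>R \<sigma> x\<^sub>2 y\<^sub>2) v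
      \<le> v \<bullet> \<sigma> (t *\<^sub>R x\<^sub>1 + (1 - t) *\<^sub>R x\<^sub>2) (t *\<^sub>R y\<^sub>1 + (1 - t) *\<^sub>R y\<^sub>2) v"
    using assms
    by (subst (asm) op_le_iff) (simp_all add: positive_opsD add_positive scaleR_positive mean_positive)
  then show ?thesis
    by (simp add: blinfun.add_left blinfun.scaleR_left inner_add_right)
qed

lemma mean_congruence:
  assumes "x \<in> positive_ops" "y \<in> positive_ops" "z \<in> selfadjoint_ops" "invertible_op z"
  shows "z o\<^sub>L \<sigma> x y o\<^sub>L z = \<sigma> (z o\<^sub>L x o\<^sub>L z) (z o\<^sub>L y o\<^sub>L z)"
  using mean assms adj_selfadjoint[OF assms(3)] unfolding kubo_ando_mean_def by metis

text \<open>Congruence by the reflection along a unit vector \<open>v\<close> fixes both scalar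
  arguments, hence their mean \<open>T\<close>. So \<open>T v\<close> is fixed by the reflection and
  lies on the line of \<open>v\<close>: every vector is an eigenvector.\<close>

lemma mean_scalar:
  assumes "0 \<le> s" "0 \<le> t"
  shows "\<exists>c. \<sigma> (s *\<^sub>R id_blinfun) (t *\<^sub>R id_blinfun) = c *\<^sub>R id_blinfun"
proof (rule scalar_of_eigenvectors)
  define T where "T = \<sigma> (s *\<^sub>R id_blinfun) (t *\<^sub>R id_blinfun)"
  have pos: "s *\<^sub>R id_blinfun \<in> positive_ops" "t *\<^sub>R id_blinfun \<in> positive_ops"
    using assms by (simp_all add: scaleR_positive id_positive)
  then have T: "T \<in> positive_ops"
    unfolding T_def by (rule mean_positive)
  have unit: "T v = (v \<bullet> T v) *\<^sub>R v" if v: "norm v = 1" for v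
  proof -
    have "dilation v (-1) o\<^sub>L T o\<^sub>L dilation v (-1) = T"
      unfolding T_def
      by (subst mean_congruence) (simp_all add: pos v dilation_congruence_scalar
          dilation_selfadjoint dilation_invertible)
    then have "dilation v (-1) (T (dilation v (-1) v)) = T v"
      by (metis blinfun_apply_blinfun_compose)
    then have "rank_one v (T v) + rank_one v (T v) = T v + T v"
      by (simp add: v dilation_self) (simp add: dilation_apply algebra_simps)
    then have "2 *\<^sub>R rank_one v (T v) = 2 *\<^sub>R T v"
      by (simp only: scaleR_2)
    then have "rank_one v (T v) = T v"
      by simp
    then have "T v = cinner v (T v) *\<^sub>C v"
      by (simp add: rank_one.rep_eq)
    \<comment> \<open>Positivity makes the eigenvalue real, as \<open>scalar_of_eigenvectors\<close>
      demands.\<close>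
    moreover have "cinner v (T v) = complex_of_real (v \<bullet> T v)"
      using T by (auto simp: positive_ops_def complex_nonneg_Reals_iff complex_eq_iff Re_cinner)
    ultimately show ?thesis
      by (simp only: scaleC_of_real)
  qed
  fix v
  show "\<exists>r. \<sigma> (s *\<^sub>R id_blinfun) (t *\<^sub>R id_blinfun) v = r *\<^sub>R v"
  proof (cases "v = 0")
    case False
    define w where "w = inverse (norm v) *\<^sub>R v"
    have "norm w = 1" "v = norm v *\<^sub>R w"
      using False by (simp_all add: w_def)
    then have "T v = (w \<bullet> T w) *\<^sub>R v"
      using unit by (metis blinfun.scaleR_right scaleR_left_commute)
    then show ?thesis
      unfolding T_def by blast
  qed (simp add: blinfun.zero_right)
qed

text \<open>Evaluation at a unit vector recovers the coefficient, so the definite description is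
  unique. On the zero space every coefficient would fit, which is why a nonzero vector is assumed in
  the lemmas on scalar means.\<close>

lemma scalar_mean_eq:
  fixes v :: 'h
  assumes "0 \<le> s" "0 \<le> t" "norm v = 1"
  shows "scalar_mean \<sigma> s t = v \<bullet> \<sigma> (s *\<^sub>R id_blinfun) (t *\<^sub>R id_blinfun) v"
proof -
  obtain c where c: "\<sigma> (s *\<^sub>R id_blinfun) (t *\<^sub>R id_blinfun) = c *\<^sub>R id_blinfun"
    using mean_scalar assms by blast
  have inj: "d = c" if "c *\<^sub>R id_blinfun = d *\<^sub>R (id_blinfun :: 'h \<Rightarrow>\<^sub>L 'h)" for d
    using arg_cong[OF that, of "\<lambda>T. v \<bullet> T v"] assms
    by (simp add: blinfun.scaleR_left flip: power2_norm_eq_inner)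
  have "scalar_mean \<sigma> s t = c"
    unfolding scalar_mean_def c by (rule the_equality[OF refl inj])
  then show ?thesis
    using assms by (simp add: c blinfun.scaleR_left flip: power2_norm_eq_inner)
qed

text \<open>
  Concavity lets one replace \<open>x\<close> and \<open>y\<close> by their pinchings along \<open>v\<close>; conjugating with
  \<open>dilation v r\<close> fixes \<open>v\<close> and makes the complementary corner negligible, so that the pinched
  operators are dominated by scalars.
\<close>

lemma mean_vector_state_le:
  assumes x: "x \<in> positive_ops" and y: "y \<in> positive_ops" and v: "norm v = 1"
    and a: "v \<bullet> x v < a" and c: "v \<bullet> y v < c"
  shows "v \<bullet> \<sigma> x y v \<le> scalar_mean \<sigma> a c"
proof -
  have ac: "0 < a" "0 < c"
    using a c positive_opsD(2)[OF x, of v] positive_opsD(2)[OF y, of v] by linarith+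
  \<comment> \<open>Small enough that the corners orthogonal to \<open>v\<close>, scaled by
    \<open>r\<^sup>2\<close>, fall below \<open>a\<close> and \<open>c\<close>; the summand
    \<open>1\<close> keeps the denominator positive.\<close>
  define r where "r = sqrt (min a c / (norm x + norm y + 1))"
  have pos: "0 < norm x + norm y + 1"
    by (simp add: add_nonneg_pos)
  have r: "r \<noteq> 0" "r\<^sup>2 * (norm x + norm y + 1) = min a c"
    using ac pos by (simp_all add: r_def)
  have r_le: "r\<^sup>2 * norm x \<le> a" "r\<^sup>2 * norm y \<le> c"
    using r(2) mult_left_mono[of "norm x" "norm x + norm y + 1" "r\<^sup>2"]
      mult_left_mono[of "norm y" "norm x + norm y + 1" "r\<^sup>2"] by simp_all
  define u where "u = dilation v (-1)"
  define z where "z = dilation v r"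
  \<comment> \<open>Averaging with the reflected operator removes the entries between
    \<open>v\<close> and its complement. The weight \<open>1 - 1/2\<close> matches
    \<open>mean_concave\<close>.\<close>
  define pinch where "pinch T = (1/2) *\<^sub>R T + (1 - 1/2) *\<^sub>R (u o\<^sub>L T o\<^sub>L u)" for T :: "'h \<Rightarrow>\<^sub>L 'h"
  have sa: "u \<in> selfadjoint_ops" "z \<in> selfadjoint_ops"
    by (simp_all add: u_def z_def dilation_selfadjoint)
  have fix_v: "u v = v" "z v = v"
    using v by (simp_all add: u_def z_def dilation_self)
  have inv: "invertible_op u" "invertible_op z"
    using v r by (simp_all add: u_def z_def dilation_invertible)
  have corner: "v \<bullet> (w o\<^sub>L T o\<^sub>L w) v = v \<bullet> T v" if "w \<in> selfadjoint_ops" "w v = v"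
    for w T :: "'h \<Rightarrow>\<^sub>L 'h"
    using selfadjoint_opsD(2)[OF that(1), of v] that(2) by simp
  have pinch_pos: "pinch T \<in> positive_ops" if "T \<in> positive_ops" for T
    unfolding pinch_def using that
    by (intro add_positive scaleR_positive positive_congruence sa) auto
  have scalar_pos: "b *\<^sub>R id_blinfun \<in> positive_ops" if "0 < b" for b
    using that by (simp add: scaleR_positive id_positive)
  have z_pinch: "w \<bullet> (z o\<^sub>L pinch T o\<^sub>L z) w \<le> w \<bullet> (b *\<^sub>R id_blinfun) w"
    if "T \<in> positive_ops" "v \<bullet> T v < b" "r\<^sup>2 * norm T \<le> b" for T b w
  proof -
    have "w \<bullet> (z o\<^sub>L pinch T o\<^sub>L z) w = z w \<bullet> pinch T (z w)"
      by (simp add: selfadjoint_opsD(2)[OF sa(2)])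
    also have "\<dots> = (1/2) * (z w \<bullet> T (z w)) + (1/2) * (u (z w) \<bullet> T (u (z w)))"
      by (simp add: pinch_def blinfun.add_left blinfun.scaleR_left inner_add_right
          selfadjoint_opsD(2)[OF sa(1)])
    also have "u (z w) = dilation v (- r) w"
      by (simp add: u_def z_def dilation_dilation v)
    also have "(1/2) * (z w \<bullet> T (z w)) + (1/2) * (dilation v (- r) w \<bullet> T (dilation v (- r) w))
        \<le> b * (norm w)\<^sup>2"
      using inner_pinch_le[OF that(1) v less_imp_le[OF that(2)] that(3), of w] by (simp add: z_def)
    finally show ?thesis
      by (simp add: blinfun.scaleR_left power2_norm_eq_inner)
  qed
  \<comment> \<open>Both halves agree because the reflection \<open>u\<close> fixes
    \<open>v\<close>; concavity then moves the average inside the mean.\<close>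
  have "v \<bullet> \<sigma> x y v = (1/2) * (v \<bullet> \<sigma> x y v) + (1 - 1/2) * (v \<bullet> (u o\<^sub>L \<sigma> x y o\<^sub>L u) v)"
    by (simp only: corner[OF sa(1) fix_v(1)]) simp
  also have "\<dots> \<le> v \<bullet> \<sigma> (pinch x) (pinch y) v"
    unfolding mean_congruence[OF x y sa(1) inv(1)] pinch_def
    by (intro mean_concave positive_congruence sa x y) auto
  also have "\<dots> = v \<bullet> (z o\<^sub>L \<sigma> (pinch x) (pinch y) o\<^sub>L z) v"
    by (simp only: corner[OF sa(2) fix_v(2)])
  also have "\<dots> \<le> v \<bullet> \<sigma> (a *\<^sub>R id_blinfun) (c *\<^sub>R id_blinfun) v"
    unfolding mean_congruence[OF pinch_pos[OF x] pinch_pos[OF y] sa(2) inv(2)]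
    by (intro mean_mono positive_congruence sa pinch_pos x y scalar_pos ac z_pinch a c r_le)
  also have "\<dots> = scalar_mean \<sigma> a c"
    using scalar_mean_eq[OF _ _ v] ac by simp
  finally show ?thesis .
qed

text \<open>At a unit vector the vector state estimate applies once both states are raised by
  \<open>d\<close>, which can be arbitrarily small; other vectors follow by homogeneity of quadratic
  forms.\<close>

lemma mean_le_linear:
  assumes x: "x \<in> positive_ops" and y: "y \<in> positive_ops" and \<alpha>: "0 \<le> \<alpha>" and \<beta>: "0 \<le> \<beta>"
    and dom: "\<And>s t. 0 < s \<Longrightarrow> 0 < t \<Longrightarrow> scalar_mean \<sigma> s t \<le> \<alpha> * s + \<beta> * t"
  shows "\<sigma> x y \<sqsubseteq> \<alpha> *\<^sub>R x + \<beta> *\<^sub>R y"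
proof -
  have unit: "w \<bullet> \<sigma> x y w \<le> \<alpha> * (w \<bullet> x w) + \<beta> * (w \<bullet> y w)" if w: "norm w = 1" for w
  proof (rule field_le_epsilon)
    fix e :: real assume "0 < e"
    \<comment> \<open>The shift gives the strict inequalities and positive arguments that the
      estimate and \<open>dom\<close> require, at a cost of at most \<open>e\<close>; the
      \<open>+ 1\<close> covers \<open>\<alpha> = \<beta> = 0\<close>.\<close>
    define d where "d = e / (\<alpha> + \<beta> + 1)"
    have d: "0 < d" "(\<alpha> + \<beta>) * d \<le> e"
      using \<alpha> \<beta> \<open>0 < e\<close> by (simp_all add: d_def field_simps)
    have "w \<bullet> \<sigma> x y w \<le> scalar_mean \<sigma> (w \<bullet> x w + d) (w \<bullet> y w + d)"
      using d by (intro mean_vector_state_le x y w) auto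
    also have "\<dots> \<le> \<alpha> * (w \<bullet> x w + d) + \<beta> * (w \<bullet> y w + d)"
      using d positive_opsD(2)[OF x, of w] positive_opsD(2)[OF y, of w] by (intro dom) auto
    also have "\<dots> \<le> \<alpha> * (w \<bullet> x w) + \<beta> * (w \<bullet> y w) + e"
      using d by (simp add: algebra_simps)
    finally show "w \<bullet> \<sigma> x y w \<le> \<alpha> * (w \<bullet> x w) + \<beta> * (w \<bullet> y w) + e" .
  qed
  have "v \<bullet> \<sigma> x y v \<le> v \<bullet> (\<alpha> *\<^sub>R x + \<beta> *\<^sub>R y) v" for v
  proof (cases "v = 0")
    case False
    define w where "w = inverse (norm v) *\<^sub>R v"
    have w: "norm w = 1" "v = norm v *\<^sub>R w"
      using False by (simp_all add: w_def)
    have scale: "v \<bullet> T v = (norm v)\<^sup>2 * (w \<bullet> T w)" for T :: "'h \<Rightarrow>\<^sub>L 'h"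
      by (subst (1 2) w(2)) (simp add: blinfun.scaleR_right power2_eq_square)
    show ?thesis
      unfolding scale using unit[OF w(1)]
      by (intro mult_left_mono)
        (simp_all add: blinfun.add_left blinfun.scaleR_left inner_add_right)
  qed simp
  then show ?thesis
    using x y \<alpha> \<beta>
    by (subst op_le_iff) (simp_all add: positive_opsD add_positive scaleR_positive mean_positive)
qed

section \<open>The scalar mean: order, homogeneity and concavity\<close>

lemma scalar_mean_nonneg:
  assumes "\<exists>v :: 'h. v \<noteq> 0" "0 \<le> s" "0 \<le> t"
  shows "0 \<le> scalar_mean \<sigma> s t"
proof -
  obtain v :: 'h where v: "norm v = 1"
    using assms(1) by (metis norm_sgn)
  then show ?thesis
    using assms by (simp add: scalar_mean_eq positive_opsD mean_positive scaleR_positive id_positive)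
qed

lemma scalar_mean_mono:
  assumes "\<exists>v :: 'h. v \<noteq> 0" "0 \<le> s" "s \<le> s'" "0 \<le> t" "t \<le> t'"
  shows "scalar_mean \<sigma> s t \<le> scalar_mean \<sigma> s' t'"
proof -
  obtain v :: 'h where v: "norm v = 1"
    using assms(1) by (metis norm_sgn)
  have "v \<bullet> \<sigma> (s *\<^sub>R id_blinfun) (t *\<^sub>R id_blinfun) v
      \<le> v \<bullet> \<sigma> (s' *\<^sub>R id_blinfun) (t' *\<^sub>R id_blinfun) v"
    using assms
    by (intro mean_mono scaleR_positive id_positive)
      (auto simp: blinfun.scaleR_left intro!: mult_right_mono)
  then show ?thesis
    using assms by (simp add: scalar_mean_eq[OF _ _ v])
qed

lemma scalar_mean_one:
  assumes "\<exists>v :: 'h. v \<noteq> 0"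
  shows "scalar_mean \<sigma> 1 1 = 1"
proof -
  obtain v :: 'h where v: "norm v = 1"
    using assms(1) by (metis norm_sgn)
  have "\<sigma> id_blinfun id_blinfun = id_blinfun"
    using mean by (simp add: kubo_ando_mean_def)
  then show ?thesis
    using v by (simp add: scalar_mean_eq[OF _ _ v] flip: power2_norm_eq_inner)
qed

text \<open>Congruence by \<open>sqrt r\<close> times the identity multiplies every operator by
  \<open>r\<close>.\<close>

lemma scalar_mean_scale:
  assumes "\<exists>v :: 'h. v \<noteq> 0" "0 < r" "0 \<le> s" "0 \<le> t"
  shows "scalar_mean \<sigma> (r * s) (r * t) = r * scalar_mean \<sigma> s t"
proof -
  obtain v :: 'h where v: "norm v = 1"
    using assms(1) by (metis norm_sgn)
  define z :: "'h \<Rightarrow>\<^sub>L 'h" where "z = sqrt r *\<^sub>R id_blinfun"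
  have z: "z \<in> selfadjoint_ops"
    unfolding z_def by (intro scaleR_selfadjoint id_selfadjoint)
  have inv: "invertible_op z"
    unfolding invertible_op_def
  proof (intro conjI bexI)
    show "z o\<^sub>L inverse (sqrt r) *\<^sub>R id_blinfun = id_blinfun"
      "inverse (sqrt r) *\<^sub>R id_blinfun o\<^sub>L z = id_blinfun"
      using assms by (auto intro!: blinfun_eqI simp: z_def blinfun.scaleR_left)
  qed (intro selfadjoint_opsD(3) z scaleR_selfadjoint id_selfadjoint)+
  have zTz: "z o\<^sub>L T o\<^sub>L z = r *\<^sub>R T" for T
    using assms by (intro blinfun_eqI) (simp add: z_def blinfun.scaleR_left blinfun.scaleR_right)
  have "r *\<^sub>R \<sigma> (s *\<^sub>R id_blinfun) (t *\<^sub>R id_blinfun)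
      = \<sigma> ((r * s) *\<^sub>R id_blinfun) ((r * t) *\<^sub>R id_blinfun)"
    using mean_congruence[of "s *\<^sub>R id_blinfun" "t *\<^sub>R id_blinfun", OF _ _ z inv] assms
    by (simp add: scaleR_positive id_positive zTz)
  from arg_cong[OF this, of "\<lambda>T. v \<bullet> T v"] show ?thesis
    using assms by (simp add: scalar_mean_eq[OF _ _ v] blinfun.scaleR_left)
qed

text \<open>Joint concavity with both first arguments equal to the identity.\<close>

lemma scalar_mean_concave:
  assumes "\<exists>v :: 'h. v \<noteq> 0"
  shows "concave_on {0<..} (scalar_mean \<sigma> 1)"
  unfolding concave_on_iff
proof (intro conjI ballI allI impI)
  obtain v :: 'h where v: "norm v = 1"
    using assms(1) by (metis norm_sgn)
  fix r s k l :: real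
  assume *: "r \<in> {0<..}" "s \<in> {0<..}" "0 \<le> k" "0 \<le> l" "k + l = 1"
  then have l: "l = 1 - k"
    by simp
  have id: "k *\<^sub>R id_blinfun + (1 - k) *\<^sub>R id_blinfun = (id_blinfun :: 'h \<Rightarrow>\<^sub>L 'h)"
    by (metis add.commute diff_add_cancel scaleR_add_left scaleR_one)
  have rs: "k *\<^sub>R r *\<^sub>R id_blinfun + (1 - k) *\<^sub>R s *\<^sub>R id_blinfun
      = (k * r + l * s) *\<^sub>R (id_blinfun :: 'h \<Rightarrow>\<^sub>L 'h)"
    by (simp add: l scaleR_add_left)
  have "k * (v \<bullet> \<sigma> id_blinfun (r *\<^sub>R id_blinfun) v)
      + (1 - k) * (v \<bullet> \<sigma> id_blinfun (s *\<^sub>R id_blinfun) v)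
    \<le> v \<bullet> \<sigma> (k *\<^sub>R id_blinfun + (1 - k) *\<^sub>R id_blinfun)
        (k *\<^sub>R r *\<^sub>R id_blinfun + (1 - k) *\<^sub>R s *\<^sub>R id_blinfun) v"
    using * by (intro mean_concave scaleR_positive id_positive) auto
  then have "k * (v \<bullet> \<sigma> id_blinfun (r *\<^sub>R id_blinfun) v)
      + (1 - k) * (v \<bullet> \<sigma> id_blinfun (s *\<^sub>R id_blinfun) v)
    \<le> v \<bullet> \<sigma> id_blinfun ((k * r + l * s) *\<^sub>R id_blinfun) v"
    unfolding id rs .
  then show "k * scalar_mean \<sigma> 1 r + l * scalar_mean \<sigma> 1 s \<le> scalar_mean \<sigma> 1 (k *\<^sub>R r + l *\<^sub>R s)"
    using * by (simp add: scalar_mean_eq[OF _ _ v] l)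
qed (simp add: convex_real_interval)

lemma scalar_mean_support:
  assumes nz: "\<exists>v :: 'h. v \<noteq> 0" and "0 < s" "0 < t"
  obtains \<alpha> \<beta> where "0 \<le> \<alpha>" "0 \<le> \<beta>" "scalar_mean \<sigma> s t = \<alpha> * s + \<beta> * t"
    "\<And>s' t'. 0 < s' \<Longrightarrow> 0 < t' \<Longrightarrow> scalar_mean \<sigma> s' t' \<le> \<alpha> * s' + \<beta> * t'"
proof -
  have "0 \<le> scalar_mean \<sigma> 1 r" if "0 < r" for r
    using scalar_mean_nonneg[OF nz] that by simp
  moreover have "scalar_mean \<sigma> 1 r \<le> scalar_mean \<sigma> 1 r'" if "0 < r" "r \<le> r'" for r r'
    using scalar_mean_mono[OF nz] that by simp
  moreover have "scalar_mean \<sigma> s t = s * scalar_mean \<sigma> 1 (t / s)" if "0 < s" "0 < t" for s t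
    using scalar_mean_scale[OF nz, of s 1 "t / s"] that by simp
  ultimately show thesis
    by (rule dominating_support[where m = "scalar_mean \<sigma>",
          OF _ _ _ scalar_mean_concave[OF nz] assms(2,3)])
      (assumption | rule that)+
qed

end

section \<open>Powers of \<open>1 - y\<close> and the compressions they induce\<close>

lemma norm_compose_commute:
  fixes S T :: "'h :: chilbert_space \<Rightarrow>\<^sub>L 'h"
  assumes "S \<in> selfadjoint_ops" "T \<in> selfadjoint_ops"
  shows "norm (S o\<^sub>L T) \<le> norm (T o\<^sub>L S)"
proof (rule norm_blinfun_bound)
  fix v
  let ?w = "S (T v)"
  \<comment> \<open>The two products are adjoint to each other: moving \<open>S\<close> and
    \<open>T\<close> across the inner product exposes \<open>T o\<^sub>L S\<close> at
    \<open>?w\<close>, and one factor \<open>norm ?w\<close> cancels.\<close>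
  have "?w \<bullet> ?w = T (S ?w) \<bullet> v"
    using selfadjoint_opsD(2)[OF assms(1), of ?w] selfadjoint_opsD(2)[OF assms(2), of "S ?w"] by simp
  also have "\<dots> \<le> norm (T (S ?w)) * norm v"
    by (rule norm_cauchy_schwarz)
  also have "\<dots> \<le> (norm (T o\<^sub>L S) * norm ?w) * norm v"
    using norm_blinfun[of "T o\<^sub>L S" ?w] by (intro mult_right_mono) auto
  finally have "norm ?w * norm ?w \<le> norm ?w * (norm (T o\<^sub>L S) * norm v)"
    by (simp add: mult_ac flip: power2_norm_eq_inner power2_eq_square)
  then show "norm ((S o\<^sub>L T) v) \<le> norm (T o\<^sub>L S) * norm v"
    by (cases "?w = 0") auto
qed simp

primrec power_op :: "('h :: chilbert_space \<Rightarrow>\<^sub>L 'h) \<Rightarrow> nat \<Rightarrow> ('h \<Rightarrow>\<^sub>L 'h)"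
  where "power_op T 0 = id_blinfun"
  | "power_op T (Suc n) = T o\<^sub>L power_op T n"

lemma power_op_commute: "T (power_op T n v) = power_op T n (T v)"
  by (induction n) auto

lemma power_op_selfadjoint: "T \<in> selfadjoint_ops \<Longrightarrow> power_op T n \<in> selfadjoint_ops"
proof (induction n)
  case (Suc n)
  then show ?case
    by (auto simp: selfadjoint_ops_def bounded_ops_def power_op_commute)
qed (simp add: id_selfadjoint)

locale positive_contraction =
  fixes y :: "'h :: chilbert_space \<Rightarrow>\<^sub>L 'h"
  assumes y: "y \<in> positive_ops" "norm y \<le> 1"
begin

abbreviation w where "w \<equiv> power_op (id_blinfun - y)"

text \<open>Approximates the identity on the range of \<open>y\<close>, yet is a polynomial in
  \<open>y\<close> without constant term and so stays in an algebra that need not contain the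
  identity.\<close>

definition h where "h n = id_blinfun - w n"

lemma w_Suc: "w (Suc n) v = w n v - y (w n v)"
  by (simp add: blinfun.diff_left)

lemma w_selfadjoint: "w n \<in> selfadjoint_ops"
  by (intro power_op_selfadjoint selfadjoint_ops_intros id_selfadjoint positive_opsD y)

text \<open>Expanding the square leaves \<open>- 2 * (u \<bullet> y u)\<close> plus the square of
  \<open>norm (y u)\<close>, which is at most \<open>u \<bullet> y u\<close>.\<close>

lemma norm_step: "(norm (u - y u))\<^sup>2 + u \<bullet> y u \<le> (norm u)\<^sup>2"
  using norm_sq_le_contraction[OF y, of u]
  by (simp add: power2_norm_eq_inner inner_diff_left inner_diff_right inner_commute)

text \<open>In operator form \<open>(1 - y) y (1 - y) \<le> y\<close>: the cube of \<open>y\<close>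
  is at most its square, which enters the expansion with factor \<open>- 2\<close>.\<close>

lemma inner_step: "(u - y u) \<bullet> y (u - y u) \<le> u \<bullet> y u"
proof -
  have "y u \<bullet> y (y u) \<le> 1 * (norm (y u))\<^sup>2"
    by (rule order_trans[OF inner_blinfun_le]) (intro mult_right_mono y, simp)
  moreover have "u \<bullet> y (y u) = y u \<bullet> y u"
    using selfadjoint_opsD(2)[OF positive_opsD(1)[OF y(1)]] by simp
  ultimately show ?thesis
    unfolding power2_norm_eq_inner blinfun.diff_right inner_diff_left inner_diff_right
    using inner_ge_zero[of "y u"] by linarith
qed

text \<open>Each further factor \<open>1 - y\<close> lowers the squared norm by at least the current
  value of the form of \<open>y\<close>, and these values decrease, so their sum dominates
  \<open>n\<close> times the last. This replaces the spectral estimate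
  \<open>n * y * (1 - y)^(2 * n) \<le> 1\<close>.\<close>

lemma norm_w_le: "(norm (w n v))\<^sup>2 + real n * (w n v \<bullet> y (w n v)) \<le> (norm v)\<^sup>2"
proof (induction n)
  case (Suc n)
  have "real (Suc n) * (w (Suc n) v \<bullet> y (w (Suc n) v)) \<le> real (Suc n) * (w n v \<bullet> y (w n v))"
    unfolding w_Suc by (intro mult_left_mono inner_step) simp
  then show ?case
    using norm_step[of "w n v"] Suc unfolding w_Suc by (simp add: algebra_simps)
qed simp

lemma norm_w_contraction: "norm (w n v) \<le> norm v"
proof (rule power2_le_imp_le)
  have "0 \<le> real n * (w n v \<bullet> y (w n v))"
    by (simp add: positive_opsD y)
  then show "(norm (w n v))\<^sup>2 \<le> (norm v)\<^sup>2"
    using norm_w_le[of n v] by linarith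
qed simp

lemma inner_w_le:
  assumes "n > 0"
  shows "w n v \<bullet> y (w n v) \<le> (norm v)\<^sup>2 / n"
proof -
  have "real n * (w n v \<bullet> y (w n v)) \<le> (norm v)\<^sup>2"
    using norm_w_le[of n v] zero_le_power2[of "norm (w n v)"] by linarith
  then show ?thesis
    using assms by (simp add: field_simps)
qed

lemma norm_w: "norm (w n) \<le> 1"
  by (rule norm_blinfun_bound) (simp_all add: norm_w_contraction)

lemma h_apply: "h n v = v - w n v"
  by (simp add: h_def blinfun.diff_left)

lemma h_selfadjoint: "h n \<in> selfadjoint_ops"
  unfolding h_def by (intro selfadjoint_ops_intros id_selfadjoint w_selfadjoint)

text \<open>The recursion avoids the identity operator, which lets membership of \<open>h n\<close>
  in the algebra be shown by induction.\<close>

lemma h_0: "h 0 = 0" and h_Suc: "h (Suc n) = h n + y - (y o\<^sub>L h n)"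
  by (auto intro!: blinfun_eqI simp: h_apply blinfun.add_left blinfun.diff_left blinfun.diff_right)

text \<open>In effect \<open>h n\<close> is the sum of \<open>w k o\<^sub>L y\<close> over
  \<open>k < n\<close>, and every \<open>w k\<close> is a contraction.\<close>

lemma norm_h_le: "norm (h n v) \<le> real n * norm (y v)"
proof (induction n)
  case (Suc n)
  have "y (w n v) = w n (y v)"
    using power_op_commute[of "id_blinfun - y" n v] by (simp add: blinfun.diff_left blinfun.diff_right)
  then have "h (Suc n) v = h n v + w n (y v)"
    unfolding h_apply w_Suc by simp
  also have "norm \<dots> \<le> real n * norm (y v) + norm (y v)"
    by (intro order_trans[OF norm_triangle_ineq] add_mono Suc.IH norm_w_contraction)
  finally show ?case
    by (simp add: algebra_simps)
qed (simp add: h_apply)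

text \<open>The chain \<open>h a h \<le> norm a * h\<^sup>2 \<le> norm a * n\<^sup>2 * y\<^sup>2
  \<le> norm a * n\<^sup>2 * y\<close>, read in quadratic forms. It makes the compressions null for
  a trace vanishing at \<open>y\<close>.\<close>

lemma h_congruence_le:
  assumes a: "a \<in> positive_ops"
  shows "h n o\<^sub>L a o\<^sub>L h n \<sqsubseteq> (norm a * (real n)\<^sup>2) *\<^sub>R y"
proof -
  have "v \<bullet> (h n o\<^sub>L a o\<^sub>L h n) v \<le> v \<bullet> ((norm a * (real n)\<^sup>2) *\<^sub>R y) v" for v
  proof -
    have "v \<bullet> (h n o\<^sub>L a o\<^sub>L h n) v = h n v \<bullet> a (h n v)"
      by (simp add: selfadjoint_opsD(2)[OF h_selfadjoint])
    also have "\<dots> \<le> norm a * (norm (h n v))\<^sup>2"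
      by (rule inner_blinfun_le)
    also have "\<dots> \<le> norm a * (real n * norm (y v))\<^sup>2"
      by (intro mult_left_mono power_mono norm_h_le) auto
    also have "\<dots> = norm a * (real n)\<^sup>2 * (norm (y v))\<^sup>2"
      by (simp add: power_mult_distrib)
    also have "\<dots> \<le> norm a * (real n)\<^sup>2 * (v \<bullet> y v)"
      by (intro mult_left_mono norm_sq_le_contraction y) auto
    finally show ?thesis
      by (simp add: blinfun.scaleR_left)
  qed
  then show ?thesis
    by (subst op_le_iff) (simp_all add: selfadjoint_ops_intros h_selfadjoint positive_opsD a y
        scaleR_selfadjoint)
qed

text \<open>By \<open>norm_sq_le\<close> the squared norm of \<open>a u\<close> is at most
  \<open>norm a\<close> times the form of \<open>a\<close> at \<open>u = w n v\<close>. There the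
  \<open>x\<close> part is bounded because \<open>w n\<close> is a contraction, the \<open>y\<close>
  part by \<open>inner_w_le\<close>.\<close>

lemma norm_compose_w_le:
  assumes a: "a \<in> positive_ops" and x: "x \<in> positive_ops" and "0 \<le> \<alpha>" "0 \<le> \<beta>" "0 < n"
    and le: "a \<sqsubseteq> \<alpha> *\<^sub>R x + \<beta> *\<^sub>R y"
  shows "(norm (a o\<^sub>L w n))\<^sup>2 \<le> norm a * (\<alpha> * norm x + \<beta> / n)"
proof -
  define c where "c = norm a * (\<alpha> * norm x + \<beta> / n)"
  have c: "0 \<le> c"
    using assms by (simp add: c_def)
  have "norm (a o\<^sub>L w n) \<le> sqrt c"
  proof (rule norm_blinfun_bound)
    fix v
    let ?u = "w n v"
    have "?u \<bullet> a ?u \<le> ?u \<bullet> (\<alpha> *\<^sub>R x + \<beta> *\<^sub>R y) ?u"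
      using le assms
      by (subst (asm) op_le_iff) (simp_all add: positive_opsD add_positive scaleR_positive y)
    also have "\<dots> = \<alpha> * (?u \<bullet> x ?u) + \<beta> * (?u \<bullet> y ?u)"
      by (simp add: blinfun.add_left blinfun.scaleR_left inner_add_right)
    also have "\<dots> \<le> \<alpha> * (norm x * (norm v)\<^sup>2) + \<beta> * ((norm v)\<^sup>2 / n)"
      using assms
      by (intro add_mono mult_left_mono inner_w_le order_trans[OF inner_blinfun_le] power_mono
          norm_w_contraction) auto
    finally have "norm a * (?u \<bullet> a ?u) \<le> norm a * (\<alpha> * (norm x * (norm v)\<^sup>2) + \<beta> * ((norm v)\<^sup>2 / n))"
      by (intro mult_left_mono) auto
    also have "\<dots> = c * (norm v)\<^sup>2"
      by (simp add: c_def algebra_simps)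
    finally have "(norm (a ?u))\<^sup>2 \<le> (sqrt c * norm v)\<^sup>2"
      using norm_sq_le[OF a, of ?u] c by (simp add: power_mult_distrib)
    then show "norm ((a o\<^sub>L w n) v) \<le> sqrt c * norm v"
      using c by (simp add: power2_le_iff_abs_le)
  qed (simp add: c)
  then have "(norm (a o\<^sub>L w n))\<^sup>2 \<le> (sqrt c)\<^sup>2"
    by (intro power_mono) auto
  then show ?thesis
    using c by (simp add: c_def)
qed

lemma compose_w_tendsto_0:
  assumes a: "a \<in> positive_ops" and x: "x \<in> positive_ops"
    and le: "\<And>\<alpha>. 0 < \<alpha> \<Longrightarrow> \<exists>\<beta>\<ge>0. a \<sqsubseteq> \<alpha> *\<^sub>R x + \<beta> *\<^sub>R y"
  shows "(\<lambda>n. norm (a o\<^sub>L w n)) \<longlonglongrightarrow> 0"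
proof (rule LIMSEQ_I)
  fix e :: real assume e: "0 < e"
  \<comment> \<open>The \<open>+ 1\<close> keeps the denominator of \<open>\<alpha>\<close> positive
    and the bound by half of \<open>e\<^sup>2\<close> strict. The coefficient \<open>\<beta>\<close>
    depends on \<open>\<alpha>\<close>, so the threshold for \<open>n\<close> is chosen after
    both.\<close>
  define p where "p = norm a * norm x + 1"
  define \<alpha> where "\<alpha> = e\<^sup>2 / (2 * p)"
  have p: "0 < p"
    by (simp add: p_def add_nonneg_pos)
  have \<alpha>: "0 < \<alpha>" "norm a * (\<alpha> * norm x) < e\<^sup>2 / 2"
  proof -
    show "0 < \<alpha>"
      using e p by (simp add: \<alpha>_def)
    then have "\<alpha> * (norm a * norm x) < \<alpha> * p"
      by (simp add: p_def)
    also have "\<dots> = e\<^sup>2 / 2"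
      using p by (simp add: \<alpha>_def)
    finally show "norm a * (\<alpha> * norm x) < e\<^sup>2 / 2"
      by (simp add: mult_ac)
  qed
  obtain \<beta> where \<beta>: "0 \<le> \<beta>" "a \<sqsubseteq> \<alpha> *\<^sub>R x + \<beta> *\<^sub>R y"
    using le[OF \<alpha>(1)] by blast
  obtain N :: nat where N: "norm a * \<beta> / (e\<^sup>2 / 2) < N"
    using reals_Archimedean2 by blast
  \<comment> \<open>Starting at \<open>Suc N\<close> keeps \<open>n\<close> positive, as the
    estimate with \<open>\<beta> / n\<close> requires.\<close>
  have "norm (a o\<^sub>L w n) < e" if n: "n \<ge> Suc N" for n
  proof -
    have "norm a * \<beta> / (e\<^sup>2 / 2) < n"
      using N n by linarith
    then have "norm a * (\<beta> / n) < e\<^sup>2 / 2"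
      using e n by (simp add: field_simps)
    moreover have "(norm (a o\<^sub>L w n))\<^sup>2 \<le> norm a * (\<alpha> * norm x + \<beta> / n)"
      using \<alpha> \<beta> n by (intro norm_compose_w_le a x) auto
    ultimately have "(norm (a o\<^sub>L w n))\<^sup>2 < e\<^sup>2"
      using \<alpha>(2) unfolding distrib_left by linarith
    then show ?thesis
      using e by (simp add: power2_less_imp_less)
  qed
  then show "\<exists>N. \<forall>n\<ge>N. norm (norm (a o\<^sub>L w n) - 0) < e"
    by (intro exI[of _ "Suc N"]) auto
qed

lemma h_congruence_tendsto:
  assumes a: "a \<in> positive_ops" and lim: "(\<lambda>n. norm (a o\<^sub>L w n)) \<longlonglongrightarrow> 0"
  shows "(\<lambda>n. h n o\<^sub>L a o\<^sub>L h n) \<longlonglongrightarrow> a"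
proof -
  have bound: "norm ((h n o\<^sub>L a o\<^sub>L h n) - a) \<le> 3 * norm (a o\<^sub>L w n)" for n
  proof -
    \<comment> \<open>Expanding \<open>h n = 1 - w n\<close>; each of the three terms has norm at
      most \<open>norm (a o\<^sub>L w n)\<close>.\<close>
    have eq: "(h n o\<^sub>L a o\<^sub>L h n) - a = (w n o\<^sub>L (a o\<^sub>L w n)) - (w n o\<^sub>L a) - (a o\<^sub>L w n)"
      by (rule blinfun_eqI) (simp add: h_apply blinfun.diff_left blinfun.diff_right)
    have "norm (w n o\<^sub>L (a o\<^sub>L w n)) \<le> norm (w n) * norm (a o\<^sub>L w n)"
      by (rule norm_blinfun_compose)
    also have "\<dots> \<le> 1 * norm (a o\<^sub>L w n)"
      by (intro mult_right_mono norm_w) simp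
    finally show ?thesis
      using norm_compose_commute[OF w_selfadjoint positive_opsD(1)[OF a], of n]
        norm_triangle_ineq4[of "(w n o\<^sub>L (a o\<^sub>L w n)) - (w n o\<^sub>L a)" "a o\<^sub>L w n"]
        norm_triangle_ineq4[of "w n o\<^sub>L (a o\<^sub>L w n)" "w n o\<^sub>L a"]
      unfolding eq by linarith
  qed
  have "(\<lambda>n. 3 * norm (a o\<^sub>L w n)) \<longlonglongrightarrow> 0"
    using tendsto_mult_left[OF lim, of 3] by simp
  then have "(\<lambda>n. (h n o\<^sub>L a o\<^sub>L h n) - a) \<longlonglongrightarrow> 0"
    by (rule Lim_null_comparison[rotated]) (intro always_eventually allI bound)
  then show ?thesis
    by (simp add: LIM_zero_iff)
qed

end

section \<open>Traces on positive parts of C*-algebras\<close>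

lemma cstar_algebra_scaleR:
  assumes "cstar_algebra A" "x \<in> A"
  shows "r *\<^sub>R x \<in> A"
proof -
  have "scalar_op (complex_of_real r) o\<^sub>L x = r *\<^sub>R x"
    by (rule blinfun_eqI) (simp add: scalar_op.rep_eq scaleC_of_real blinfun.scaleR_left)
  then show ?thesis
    using assms by (metis cstar_algebra_def)
qed

lemma cstar_algebra_ops:
  assumes "cstar_algebra A" "x \<in> A" "y \<in> A"
  shows "x + y \<in> A" "x - y \<in> A" "x o\<^sub>L y \<in> A"
proof -
  show "x + y \<in> A" "x o\<^sub>L y \<in> A"
    using assms by (simp_all add: cstar_algebra_def)
  have "- y \<in> A"
    using cstar_algebra_scaleR[OF assms(1,3), of "-1"] by simp
  then have "x + - y \<in> A"
    using assms unfolding cstar_algebra_def by blast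
  then show "x - y \<in> A"
    by simp
qed

lemma positive_partD: "x \<in> positive_part A \<Longrightarrow> x \<in> A" "x \<in> positive_part A \<Longrightarrow> x \<in> positive_ops"
  by (simp_all add: positive_part_def)

lemma trace_mono:
  assumes "cstar_algebra A" "trace_on A \<tau>" "x \<in> positive_part A" "y \<in> positive_part A" "x \<sqsubseteq> y"
  shows "\<tau> x \<le> \<tau> y"
proof -
  have "y - x \<in> positive_part A"
    using assms by (simp add: positive_part_def op_le_def cstar_algebra_ops)
  then have "\<tau> (x + (y - x)) = \<tau> x + \<tau> (y - x)"
    using assms unfolding trace_on_def by blast
  then show ?thesis
    by simp
qed

lemma trace_linear_comb:
  assumes A: "cstar_algebra A" "trace_on A \<tau>" and x: "x \<in> positive_part A" and y: "y \<in> positive_part A"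
    and "0 \<le> \<alpha>" "0 \<le> \<beta>"
  shows "\<alpha> *\<^sub>R x + \<beta> *\<^sub>R y \<in> positive_part A"
    "\<tau> (\<alpha> *\<^sub>R x + \<beta> *\<^sub>R y) = ennreal \<alpha> * \<tau> x + ennreal \<beta> * \<tau> y"
proof -
  have scale: "r *\<^sub>R z \<in> positive_part A" if "z \<in> positive_part A" "0 \<le> r" for r z
    using that A by (simp add: positive_part_def cstar_algebra_scaleR scaleR_positive)
  then show "\<alpha> *\<^sub>R x + \<beta> *\<^sub>R y \<in> positive_part A"
    using assms by (simp add: positive_part_def cstar_algebra_ops add_positive)
  have "\<tau> (\<alpha> *\<^sub>R x + \<beta> *\<^sub>R y) = \<tau> (\<alpha> *\<^sub>R x) + \<tau> (\<beta> *\<^sub>R y)"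
    using A scale assms unfolding trace_on_def by blast
  then show "\<tau> (\<alpha> *\<^sub>R x + \<beta> *\<^sub>R y) = ennreal \<alpha> * \<tau> x + ennreal \<beta> * \<tau> y"
    using assms by (simp add: trace_on_def)
qed

text \<open>
  Modulo the closed ideal generated by \<open>y\<close> the element \<open>a\<close> is dominated by every positive multiple
  of \<open>x\<close>. With \<open>h = 1 - (1 - y)\<^sup>n\<close>, for \<open>y\<close> a contraction, the compressions \<open>h a h\<close> are dominated
  by multiples of \<open>y\<close> and converge to \<open>a\<close>.
\<close>

lemma trace_eq_0:
  assumes A: "cstar_algebra A" "trace_on A \<tau>" and lsc: "lower_semicontinuous_on (positive_part A) \<tau>"
    and a: "a \<in> positive_part A" and x: "x \<in> positive_part A" and y: "y \<in> positive_part A"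
    and null: "\<tau> y = 0"
    and le: "\<And>\<alpha>. 0 < \<alpha> \<Longrightarrow> \<exists>\<beta>\<ge>0. a \<sqsubseteq> \<alpha> *\<^sub>R x + \<beta> *\<^sub>R y"
  shows "\<tau> a = 0"
proof -
  \<comment> \<open>Dividing by \<open>r\<close> makes \<open>y\<close> a contraction; the
    \<open>+ 1\<close> allows for \<open>norm y = 0\<close>.\<close>
  define r where "r = norm y + 1"
  have r: "0 < r"
    by (simp add: r_def add_nonneg_pos)
  define y' where "y' = inverse r *\<^sub>R y"
  have y': "y' \<in> positive_part A" "\<tau> y' = 0"
    using trace_linear_comb[OF A y y, of "inverse r" 0] r null by (simp_all add: y'_def)
  interpret positive_contraction y'
  proof
    show "y' \<in> positive_ops"
      using y' by (simp add: positive_partD)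
    show "norm y' \<le> 1"
      using r by (simp add: y'_def r_def divide_simps)
  qed
  have le': "\<exists>\<beta>\<ge>0. a \<sqsubseteq> \<alpha> *\<^sub>R x + \<beta> *\<^sub>R y'" if "0 < \<alpha>" for \<alpha>
  proof -
    obtain \<beta> where "0 \<le> \<beta>" "a \<sqsubseteq> \<alpha> *\<^sub>R x + \<beta> *\<^sub>R y"
      using le \<open>0 < \<alpha>\<close> by blast
    then show ?thesis
      using r by (intro exI[of _ "\<beta> * r"]) (simp add: y'_def mult.assoc)
  qed
  have lim: "(\<lambda>n. h n o\<^sub>L a o\<^sub>L h n) \<longlonglongrightarrow> a"
    using a x le' by (intro h_congruence_tendsto compose_w_tendsto_0[of a x]) (simp_all add: positive_partD)
  have "h n \<in> A" for n
  proof (induction n)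
    case 0
    then show ?case
      using A by (simp add: h_0 cstar_algebra_def)
  next
    case (Suc n)
    then show ?case
      unfolding h_Suc using A y' by (simp add: cstar_algebra_ops positive_partD)
  qed
  then have hah: "h n o\<^sub>L a o\<^sub>L h n \<in> positive_part A" for n
    using A a by (simp add: positive_part_def cstar_algebra_ops positive_congruence h_selfadjoint)
  have "\<tau> (h n o\<^sub>L a o\<^sub>L h n) = 0" for n
  proof -
    define c where "c = norm a * (real n)\<^sup>2"
    have "c *\<^sub>R y' \<in> positive_part A" "\<tau> (c *\<^sub>R y') = 0"
      using trace_linear_comb[OF A y'(1) y'(1), of c 0] y'(2) by (simp_all add: c_def)
    moreover have "h n o\<^sub>L a o\<^sub>L h n \<sqsubseteq> c *\<^sub>R y'"
      unfolding c_def using a by (intro h_congruence_le) (simp add: positive_partD)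
    ultimately show ?thesis
      using trace_mono[OF A hah] by fastforce
  qed
  \<comment> \<open>Lower semi-continuity enters at level \<open>0\<close>: the null elements are
    relatively closed in the positive part, so the limit \<open>a\<close> is null.\<close>
  moreover obtain C where C: "closed C" "{z \<in> positive_part A. \<tau> z \<le> 0} = positive_part A \<inter> C"
    using lsc unfolding lower_semicontinuous_on_def closedin_closed by blast
  ultimately have "h n o\<^sub>L a o\<^sub>L h n \<in> C" for n
    using hah by auto
  then have "a \<in> C"
    using closed_sequentially[OF C(1) _ lim] by blast
  then show ?thesis
    using C(2) a by auto
qed

text \<open>An arbitrary \<open>a\<close> below \<open>\<sigma> x y\<close> stands in for the mean,
  which serves both branches of \<open>trace_value\<close>. The operator inequality is kept as a
  conclusion for the case of trace zero.\<close>

lemma trace_le_of_dominating: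
  assumes mean: "kubo_ando_mean \<sigma>" and A: "cstar_algebra A" "trace_on A \<tau>"
    and x: "x \<in> positive_part A" and y: "y \<in> positive_part A"
    and a: "a \<in> positive_part A" "a \<sqsubseteq> \<sigma> x y" and "0 \<le> \<alpha>" "0 \<le> \<beta>"
    and dom: "\<And>s t. 0 < s \<Longrightarrow> 0 < t \<Longrightarrow> scalar_mean \<sigma> s t \<le> \<alpha> * s + \<beta> * t"
  shows "a \<sqsubseteq> \<alpha> *\<^sub>R x + \<beta> *\<^sub>R y" "\<tau> a \<le> ennreal \<alpha> * \<tau> x + ennreal \<beta> * \<tau> y"
proof -
  have "\<sigma> x y \<sqsubseteq> \<alpha> *\<^sub>R x + \<beta> *\<^sub>R y"
    using assms by (intro mean_le_linear) (auto simp: positive_partD)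
  then have "(\<sigma> x y - a) + (\<alpha> *\<^sub>R x + \<beta> *\<^sub>R y - \<sigma> x y) \<in> positive_ops"
    using a(2) unfolding op_le_def by (intro add_positive)
  then show le: "a \<sqsubseteq> \<alpha> *\<^sub>R x + \<beta> *\<^sub>R y"
    by (simp add: op_le_def)
  show "\<tau> a \<le> ennreal \<alpha> * \<tau> x + ennreal \<beta> * \<tau> y"
    using trace_mono[OF A a(1) trace_linear_comb(1) le] trace_linear_comb(2) assms by metis
qed

text \<open>The majorant touching the scalar mean at \<open>(s, t)\<close> has exactly its value
  there. Positive upper bounds \<open>s\<close> and \<open>t\<close> in place of the traces admit
  traces equal to \<open>0\<close>.\<close>

lemma trace_le_finite:
  fixes \<sigma> :: "('h :: chilbert_space \<Rightarrow>\<^sub>L 'h) \<Rightarrow> ('h \<Rightarrow>\<^sub>L 'h) \<Rightarrow> ('h \<Rightarrow>\<^sub>L 'h)"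
  assumes nz: "\<exists>v :: 'h. v \<noteq> 0"
    and mean: "kubo_ando_mean \<sigma>" and A: "cstar_algebra A" "trace_on A \<tau>"
    and x: "x \<in> positive_part A" and y: "y \<in> positive_part A"
    and a: "a \<in> positive_part A" "a \<sqsubseteq> \<sigma> x y"
    and st: "0 < s" "0 < t" "\<tau> x \<le> ennreal s" "\<tau> y \<le> ennreal t"
  shows "\<tau> a \<le> ennreal (scalar_mean \<sigma> s t)"
proof -
  obtain \<alpha> \<beta> where *: "0 \<le> \<alpha>" "0 \<le> \<beta>" "scalar_mean \<sigma> s t = \<alpha> * s + \<beta> * t"
    and dom: "\<And>s' t'. 0 < s' \<Longrightarrow> 0 < t' \<Longrightarrow> scalar_mean \<sigma> s' t' \<le> \<alpha> * s' + \<beta> * t'"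
    using scalar_mean_support[OF mean nz st(1,2)] by blast
  have "\<tau> a \<le> ennreal \<alpha> * \<tau> x + ennreal \<beta> * \<tau> y"
    by (rule trace_le_of_dominating(2)[OF mean A x y a *(1,2) dom])
  also have "\<dots> \<le> ennreal \<alpha> * ennreal s + ennreal \<beta> * ennreal t"
    by (intro add_mono mult_left_mono st) auto
  also have "\<dots> = ennreal (scalar_mean \<sigma> s t)"
    using * st by (simp add: ennreal_mult ennreal_plus)
  finally show ?thesis .
qed

section \<open>The extended scalar mean and infinite traces\<close>

definition truncated_mean ::
    "(('h :: chilbert_space \<Rightarrow>\<^sub>L 'h) \<Rightarrow> ('h \<Rightarrow>\<^sub>L 'h) \<Rightarrow> ('h \<Rightarrow>\<^sub>L 'h)) \<Rightarrow> ennreal \<Rightarrow> ennreal \<Rightarrow> nat \<Rightarrow> ennreal"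
  where "truncated_mean \<sigma> s t n = (INF e\<in>{0<..}.
    ennreal (scalar_mean \<sigma> (enn2real (min s (of_nat n)) + e) (enn2real (min t (of_nat n)) + e)))"

lemma ext_scalar_mean_eq_SUP:
  assumes "\<not> (0 < s \<and> s < \<infinity> \<and> 0 < t \<and> t < \<infinity>)"
  shows "ext_scalar_mean \<sigma> s t = (SUP n. truncated_mean \<sigma> s t n)"
  unfolding ext_scalar_mean_def truncated_mean_def if_not_P[OF assms] ..

lemma trace_le_ext_finite:
  fixes \<sigma> :: "('h :: chilbert_space \<Rightarrow>\<^sub>L 'h) \<Rightarrow> ('h \<Rightarrow>\<^sub>L 'h) \<Rightarrow> ('h \<Rightarrow>\<^sub>L 'h)"
  assumes nz: "\<exists>v :: 'h. v \<noteq> 0"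
    and mean: "kubo_ando_mean \<sigma>" and A: "cstar_algebra A" "trace_on A \<tau>"
    and x: "x \<in> positive_part A" and y: "y \<in> positive_part A"
    and a: "a \<in> positive_part A" "a \<sqsubseteq> \<sigma> x y"
    and fin: "\<tau> x < \<infinity>" "\<tau> y < \<infinity>"
  shows "\<tau> a \<le> ext_scalar_mean \<sigma> (\<tau> x) (\<tau> y)"
proof -
  obtain s t where st: "0 \<le> s" "0 \<le> t" "\<tau> x = ennreal s" "\<tau> y = ennreal t"
    using fin by (cases "\<tau> x"; cases "\<tau> y") auto
  show ?thesis
  proof (cases "0 < s \<and> 0 < t")
    case True
    then show ?thesis
      using trace_le_finite[OF nz mean A x y a, of s t] st by (simp add: ext_scalar_mean_def)
  next
    case False
    \<comment> \<open>At this level truncation alters neither trace; adding \<open>e > 0\<close>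
      then makes both arguments positive upper bounds.\<close>
    obtain n :: nat where n: "s + t \<le> n"
      using real_arch_simple by blast
    have min: "min (ennreal s) (of_nat n) = ennreal s" "min (ennreal t) (of_nat n) = ennreal t"
      using n st(1,2) by (simp_all add: min_absorb1 ennreal_of_nat_eq_real_of_nat)
    have "\<tau> a \<le> truncated_mean \<sigma> (\<tau> x) (\<tau> y) n"
      unfolding truncated_mean_def
    proof (rule INF_greatest)
      fix e :: real assume "e \<in> {0<..}"
      then show "\<tau> a \<le> ennreal (scalar_mean \<sigma> (enn2real (min (\<tau> x) (of_nat n)) + e)
          (enn2real (min (\<tau> y) (of_nat n)) + e))"
        using st by (simp add: min) (intro trace_le_finite[OF nz mean A x y a], auto intro: ennreal_leI)
    qed
    also have "\<dots> \<le> ext_scalar_mean \<sigma> (\<tau> x) (\<tau> y)"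
      using False st by (subst ext_scalar_mean_eq_SUP) (auto intro: SUP_upper)
    finally show ?thesis .
  qed
qed

text \<open>By homogeneity and normalisation the mean of \<open>n + e\<close> with itself is
  \<open>n + e\<close>, so level \<open>n\<close> contributes at least \<open>n\<close>.\<close>

lemma ext_scalar_mean_top_top:
  fixes \<sigma> :: "('h :: chilbert_space \<Rightarrow>\<^sub>L 'h) \<Rightarrow> ('h \<Rightarrow>\<^sub>L 'h) \<Rightarrow> ('h \<Rightarrow>\<^sub>L 'h)"
  assumes nz: "\<exists>v :: 'h. v \<noteq> 0" and mean: "kubo_ando_mean \<sigma>"
  shows "ext_scalar_mean \<sigma> \<infinity> \<infinity> = \<infinity>"
proof -
  have "of_nat n \<le> truncated_mean \<sigma> \<infinity> \<infinity> n" for n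
    unfolding truncated_mean_def
  proof (rule INF_greatest)
    fix e :: real assume e: "e \<in> {0<..}"
    have "scalar_mean \<sigma> (n + e) (n + e) = n + e"
      using scalar_mean_scale[OF mean nz, of "n + e" 1 1] scalar_mean_one[OF mean nz] e by simp
    then show "of_nat n \<le> ennreal (scalar_mean \<sigma> (enn2real (min \<infinity> (of_nat n)) + e)
        (enn2real (min \<infinity> (of_nat n)) + e))"
      using e by (simp add: ennreal_of_nat_eq_real_of_nat ennreal_leI)
  qed
  then have "(SUP n. of_nat n) \<le> (SUP n. truncated_mean \<sigma> \<infinity> \<infinity> n)"
    by (intro SUP_mono) auto
  then show ?thesis
    by (simp add: ext_scalar_mean_eq_SUP ennreal_SUP_of_nat_eq_top top_unique)
qed

text \<open>Only a finite right-hand side \<open>L\<close> needs an argument. If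
  \<open>\<tau> y = 0\<close>, boundedness along first arguments \<open>n\<close> with vanishing
  second argument forces majorants with arbitrarily small coefficient of \<open>x\<close>, and
  \<open>trace_eq_0\<close> applies. If \<open>\<tau> y > 0\<close>, boundedness in the first
  variable gives a majorant with coefficient \<open>0\<close> there.\<close>

lemma trace_le_ext_infinite:
  fixes \<sigma> :: "('h :: chilbert_space \<Rightarrow>\<^sub>L 'h) \<Rightarrow> ('h \<Rightarrow>\<^sub>L 'h) \<Rightarrow> ('h \<Rightarrow>\<^sub>L 'h)"
  assumes nz: "\<exists>v :: 'h. v \<noteq> 0"
    and mean: "kubo_ando_mean \<sigma>" and A: "cstar_algebra A" "trace_on A \<tau>"
    and lsc: "lower_semicontinuous_on (positive_part A) \<tau>"
    and x: "x \<in> positive_part A" and y: "y \<in> positive_part A"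
    and a: "a \<in> positive_part A" "a \<sqsubseteq> \<sigma> x y"
    and inf: "\<tau> x = \<infinity>" and fin: "\<tau> y < \<infinity>"
  shows "\<tau> a \<le> ext_scalar_mean \<sigma> (\<tau> x) (\<tau> y)"
proof (cases "ext_scalar_mean \<sigma> (\<tau> x) (\<tau> y)")
  case (real L)
  obtain t where t: "0 \<le> t" "\<tau> y = ennreal t"
    using fin by (cases "\<tau> y") auto
  have le_L: "truncated_mean \<sigma> \<infinity> (ennreal t) n \<le> ennreal L" for n
  proof -
    have "ennreal L = (SUP n. truncated_mean \<sigma> \<infinity> (ennreal t) n)"
      using real(2) by (simp add: ext_scalar_mean_eq_SUP inf t(2))
    then show ?thesis
      by (simp add: SUP_upper)
  qed
  show ?thesis
  proof (cases "t = 0")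
    case True
    have "\<exists>\<beta>\<ge>0. a \<sqsubseteq> \<alpha> *\<^sub>R x + \<beta> *\<^sub>R y" if "0 < \<alpha>" for \<alpha>
    proof -
      \<comment> \<open>So large that \<open>L < \<alpha> * n\<close>: a mean below
        \<open>\<alpha> * n\<close> at first argument \<open>n + e\<close> leaves its touching
        majorant a first coefficient of at most \<open>\<alpha>\<close>.\<close>
      obtain n :: nat where n: "L / \<alpha> < n"
        using reals_Archimedean2 by blast
      have "0 < n"
        using n \<open>0 < \<alpha>\<close> real(1) by (metis divide_nonneg_pos of_nat_0_less_iff order_le_less_trans)
      have "ennreal L < ennreal (\<alpha> * n)"
        using n \<open>0 < \<alpha>\<close> real(1) by (intro ennreal_lessI) (simp_all add: field_simps \<open>0 < n\<close>)
      then have "truncated_mean \<sigma> \<infinity> (ennreal t) n < ennreal (\<alpha> * n)"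
        using le_L order_le_less_trans by blast
      then obtain e :: real where e: "0 < e" "ennreal (scalar_mean \<sigma> (n + e) e) < ennreal (\<alpha> * n)"
        unfolding truncated_mean_def INF_less_iff by (auto simp: True)
      then have lt: "scalar_mean \<sigma> (n + e) e < \<alpha> * n"
        using \<open>0 < \<alpha>\<close> by (metis ennreal_leI linorder_not_less)
      obtain \<alpha>' \<beta> where *: "0 \<le> \<alpha>'" "0 \<le> \<beta>" "scalar_mean \<sigma> (n + e) e = \<alpha>' * (n + e) + \<beta> * e"
        and dom: "\<And>s' t'. 0 < s' \<Longrightarrow> 0 < t' \<Longrightarrow> scalar_mean \<sigma> s' t' \<le> \<alpha>' * s' + \<beta> * t'"
        using scalar_mean_support[OF mean nz, of "n + e" e] e by (metis add_nonneg_pos of_nat_0_le_iff)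
      have "\<alpha>' * n < \<alpha> * n"
        using lt * e by (smt (verit) distrib_left mult_nonneg_nonneg)
      then have "\<alpha>' \<le> \<alpha>"
        using \<open>0 < n\<close> by simp
      then have "scalar_mean \<sigma> s' t' \<le> \<alpha> * s' + \<beta> * t'" if "0 < s'" "0 < t'" for s' t'
        using dom[OF that] mult_right_mono[of \<alpha>' \<alpha> s'] that by linarith
      then show ?thesis
        using trace_le_of_dominating(1)[OF mean A x y a, of \<alpha> \<beta>] * \<open>0 < \<alpha>\<close> by auto
    qed
    then have "\<tau> a = 0"
      using t True by (intro trace_eq_0[OF A lsc a(1) x y]) auto
    then show ?thesis
      by simp
  next
    case False
    with t have "0 < t" by simp
    have bound: "scalar_mean \<sigma> s t \<le> L" if "0 < s" for s
    proof -
      \<comment> \<open>Large enough that \<open>n\<close> is at least \<open>s\<close> and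
        truncation leaves \<open>t\<close> unchanged.\<close>
      obtain n :: nat where n: "s + t \<le> n"
        using real_arch_simple by blast
      have min: "min (ennreal t) (of_nat n) = ennreal t"
        using n \<open>0 < s\<close> t by (simp add: min_absorb1 ennreal_of_nat_eq_real_of_nat)
      have "ennreal (scalar_mean \<sigma> s t) \<le> truncated_mean \<sigma> \<infinity> (ennreal t) n"
        unfolding truncated_mean_def
      proof (rule INF_greatest)
        fix e :: real assume "e \<in> {0<..}"
        then show "ennreal (scalar_mean \<sigma> s t) \<le> ennreal (scalar_mean \<sigma>
            (enn2real (min \<infinity> (of_nat n)) + e) (enn2real (min (ennreal t) (of_nat n)) + e))"
          using n t \<open>0 < s\<close>
          by (intro ennreal_leI scalar_mean_mono[OF mean nz]) (auto simp: min)
      qed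
      then have "ennreal (scalar_mean \<sigma> s t) \<le> ennreal L"
        using le_L order_trans by blast
      then show ?thesis
        using real(1) by (simp add: ennreal_le_iff)
    qed
    \<comment> \<open>Homogeneity moves the second argument to \<open>t\<close>, where
      \<open>bound\<close> holds for every positive first argument.\<close>
    have "scalar_mean \<sigma> s' t' \<le> 0 * s' + (L / t) * t'" if "0 < s'" "0 < t'" for s' t'
    proof -
      have "scalar_mean \<sigma> s' t' = (t' / t) * scalar_mean \<sigma> (s' * t / t') t"
        using scalar_mean_scale[OF mean nz, of "t' / t" "s' * t / t'" t] that \<open>0 < t\<close> by simp
      also have "\<dots> \<le> (t' / t) * L"
        using that \<open>0 < t\<close> by (intro mult_left_mono bound) auto
      finally show ?thesis
        by (simp add: mult.commute)
    qed
    then have "\<tau> a \<le> ennreal 0 * \<tau> x + ennreal (L / t) * \<tau> y"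
      using real(1) t by (intro trace_le_of_dominating(2)[OF mean A x y a]) auto
    \<comment> \<open>In \<open>ennreal\<close> the product of \<open>0\<close> and
      \<open>\<infinity>\<close> is \<open>0\<close>, so the infinite trace of \<open>x\<close>
      disappears.\<close>
    also have "\<dots> = ennreal L"
      using real(1) \<open>0 < t\<close> by (simp add: t(2) flip: ennreal_mult)
    finally show ?thesis
      using real(2) by simp
  qed
qed simp

section \<open>Exchange of arguments and the general inequality\<close>

lemma kubo_ando_mean_swap:
  assumes "kubo_ando_mean \<sigma>"
  shows "kubo_ando_mean (\<lambda>x y. \<sigma> y x)"
  using assms unfolding kubo_ando_mean_def by (intro conjI; blast)

lemma ext_scalar_mean_swap: "ext_scalar_mean (\<lambda>x y. \<sigma> y x) s t = ext_scalar_mean \<sigma> t s"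
  unfolding ext_scalar_mean_def scalar_mean_def by (simp add: conj_ac)

lemma trace_le_ext_scalar_mean:
  fixes \<sigma> :: "('h :: chilbert_space \<Rightarrow>\<^sub>L 'h) \<Rightarrow> ('h \<Rightarrow>\<^sub>L 'h) \<Rightarrow> ('h \<Rightarrow>\<^sub>L 'h)"
  assumes mean: "kubo_ando_mean \<sigma>" and A: "cstar_algebra A" "trace_on A \<tau>"
    and lsc: "lower_semicontinuous_on (positive_part A) \<tau>"
    and x: "x \<in> positive_part A" and y: "y \<in> positive_part A"
    and a: "a \<in> positive_part A" "a \<sqsubseteq> \<sigma> x y"
  shows "\<tau> a \<le> ext_scalar_mean \<sigma> (\<tau> x) (\<tau> y)"
proof (cases "\<exists>v :: 'h. v \<noteq> 0")
  case nz: True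
  consider "\<tau> x < \<infinity>" "\<tau> y < \<infinity>" | "\<tau> x = \<infinity>" "\<tau> y = \<infinity>"
    | "\<tau> x = \<infinity>" "\<tau> y < \<infinity>" | "\<tau> y = \<infinity>" "\<tau> x < \<infinity>"
    by (metis infinity_ennreal_def less_top)
  then show ?thesis
  proof cases
    case 1
    then show ?thesis
      by (rule trace_le_ext_finite[OF nz mean A x y a])
  next
    case 2
    then show ?thesis
      by (simp add: ext_scalar_mean_top_top[OF nz mean, simplified])
  next
    case 3
    then show ?thesis
      by (rule trace_le_ext_infinite[OF nz mean A lsc x y a])
  next
    case 4
    \<comment> \<open>Exchanging the arguments reduces an infinite \<open>\<tau> y\<close> to the
      case of an infinite \<open>\<tau> x\<close>.\<close>
    then have "\<tau> a \<le> ext_scalar_mean (\<lambda>x y. \<sigma> y x) (\<tau> y) (\<tau> x)"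
      by (rule trace_le_ext_infinite[OF nz kubo_ando_mean_swap[OF mean] A lsc y x a])
    also have "\<dots> = ext_scalar_mean \<sigma> (\<tau> x) (\<tau> y)"
      by (rule ext_scalar_mean_swap)
    finally show ?thesis .
  qed
next
  case False
  \<comment> \<open>On the zero space \<open>a\<close> is \<open>0\<close>, and homogeneity of the
    trace with factor \<open>0\<close> gives it trace \<open>0\<close>.\<close>
  then have "a = 0 *\<^sub>R a"
    by (intro blinfun_eqI) metis
  then have "\<tau> a = ennreal 0 * \<tau> a"
    using A a(1) unfolding trace_on_def by (metis order_refl)
  then show ?thesis
    by simp
qed

theorem proposition23:
  fixes A :: "('h :: chilbert_space \<Rightarrow>\<^sub>L 'h) set"
    and \<sigma> :: "('h \<Rightarrow>\<^sub>L 'h) \<Rightarrow> ('h \<Rightarrow>\<^sub>L 'h) \<Rightarrow> ('h \<Rightarrow>\<^sub>L 'h)"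
    and \<tau> :: "('h \<Rightarrow>\<^sub>L 'h) \<Rightarrow> ennreal"
    and x y :: "'h \<Rightarrow>\<^sub>L 'h"
  assumes "kubo_ando_mean \<sigma>"
    and "cstar_algebra A"
    and "trace_on A \<tau>"
    and "densely_defined A \<tau>"
    and "lower_semicontinuous_on (positive_part A) \<tau>"
    and "x \<in> positive_part A"
    and "y \<in> positive_part A"
  shows "trace_value A \<tau> (\<sigma> x y) \<le> ext_scalar_mean \<sigma> (\<tau> x) (\<tau> y)"
proof (cases "\<sigma> x y \<in> positive_part A")
  case True
  \<comment> \<open>Reflexivity admits the mean itself as the element \<open>a\<close>.\<close>
  have "\<sigma> x y \<sqsubseteq> \<sigma> x y"
    using True by (simp add: op_le_iff positive_partD positive_opsD)
  then show ?thesis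
    using trace_le_ext_scalar_mean[OF assms(1-3,5-7) True] True by (simp add: trace_value_def)
next
  case False
  \<comment> \<open>Outside the algebra the trace value is a supremum over elements below the mean,
    each covered by the same bound.\<close>
  then show ?thesis
    using trace_le_ext_scalar_mean[OF assms(1-3,5-7)]
    by (auto simp: trace_value_def intro!: SUP_least)
qed

end
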